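(* Let $f(t,X)\in\mathbb{Q}(t)[X]$ be irreducible over $\mathbb{Q}(t)$, and let $x$ be a root of $f$. Assume that $\mathbb{Q}(t,x)$ has a rational unramified place above the place $t\mapsto\infty$ of $\mathbb{Q}(t)$. Then $f(\bar t,X)$ is irreducible over $\mathbb{Q}$ for all but finitely many $\bar t\in\mathbb{Z}$.
   Context: Here $t$ is transcendental over $\mathbb{Q}$, and $x$ lies in an algebraic closure of $\mathbb{Q}(t)$. $f(\bar t,X)$ denotes the specialization of $f$ at $t=\bar t$; it is defined for all but finitely many $\bar t$. A place of $\mathbb{Q}(t,x)$ above $t\mapsto\infty$ is rational if its residue field is $\mathbb{Q}$, and unramified if its ramification index over $t\mapsto\infty$ is $1$. *)

theory Defs
  imports
    "HOL-Algebra.Algebraic_Closure_Type"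
    "HOL-Algebra.Generated_Fields"
    "HOL-Algebra.QuotRing"
    "HOL-Computational_Algebra.Computational_Algebra"
    "HOL-Computational_Algebra.Field_as_Ring"
begin

text \<open>
  \<open>\<rat>(t)\<close> is \<^typ>\<open>rat poly fract\<close>, with \<open>t\<close> the polynomial variable, and its algebraic
  closure is \<^typ>\<open>rat poly fract alg_closure\<close>, into which it embeds by \<^const>\<open>to_ac\<close>.
\<close>

type_synonym ratfun = "rat poly fract"


subsection \<open>Specialization at \<open>t = c\<close>\<close>

text \<open>\<^const>\<open>quot_of_fract\<close> is the fraction in lowest terms, so \<open>r\<close> has a pole at \<open>c\<close> iff its
  denominator vanishes there.\<close>

definition regular_at :: "rat \<Rightarrow> ratfun \<Rightarrow> bool" where
  "regular_at c r \<longleftrightarrow> poly (snd (quot_of_fract r)) c \<noteq> 0"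

definition ratfun_eval :: "rat \<Rightarrow> ratfun \<Rightarrow> rat" where
  "ratfun_eval c r = poly (fst (quot_of_fract r)) c / poly (snd (quot_of_fract r)) c"

definition specializable :: "rat \<Rightarrow> ratfun poly \<Rightarrow> bool" where
  "specializable c f \<longleftrightarrow> (\<forall>i. regular_at c (Polynomial.coeff f i))"

definition specialize :: "rat \<Rightarrow> ratfun poly \<Rightarrow> rat poly" where
  "specialize c f = map_poly (ratfun_eval c) f"


subsection \<open>Places of a field, given by their valuation rings\<close>

text \<open>\<open>V\<close> is the valuation ring of a place of \<open>K\<close> that is trivial on the subfield \<open>k\<close>.\<close>

definition is_place :: "'a::field set \<Rightarrow> 'a set \<Rightarrow> 'a set \<Rightarrow> bool" where
  "is_place k K V \<longleftrightarrow>
     subring V ring_of_type_algebra \<and> k \<subseteq> V \<and> V \<subset> K \<and> (\<forall>z\<in>K. z \<in> V \<or> inverse z \<in> V)"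

definition place_ideal :: "'a::field set \<Rightarrow> 'a set" where
  "place_ideal V = {z \<in> V. z = 0 \<or> inverse z \<notin> V}"

definition residue_field :: "'a::field set \<Rightarrow> 'a set ring" where
  "residue_field V = (ring_of_type_algebra\<lparr>carrier := V\<rparr>) Quot (place_ideal V)"

text \<open>The index of the value group of \<open>V \<inter> F\<close> in that of \<open>V\<close>. The value group of \<open>V\<close> is
  \<open>K\<^sup>* / V\<^sup>*\<close> and the image of \<open>F\<^sup>*\<close> in it is \<open>F\<^sup>* V\<^sup>* / V\<^sup>*\<close>, so this is the
  index of \<open>F\<^sup>* V\<^sup>*\<close> in \<open>K\<^sup>*\<close> (and \<open>0\<close> if that index is infinite).\<close>

definition ramification_index :: "'a::field set \<Rightarrow> 'a set \<Rightarrow> 'a set \<Rightarrow> nat" where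
  "ramification_index F K V =
     (let R = ring_of_type_algebra; G = units_of (R\<lparr>carrier := K\<rparr>)
      in card (rcosets\<^bsub>G\<^esub> (Units (R\<lparr>carrier := F\<rparr>) <#>\<^bsub>G\<^esub> Units (R\<lparr>carrier := V\<rparr>))))"


subsection \<open>Places of \<open>\<rat>(t, x)\<close> above \<open>t \<mapsto> \<infinity>\<close>\<close>

text \<open>The rational functions that are finite at \<open>t = \<infinity>\<close>.\<close>

definition infinity_ring :: "ratfun set" where
  "infinity_ring =
     {r. Polynomial.degree (fst (quot_of_fract r)) \<le> Polynomial.degree (snd (quot_of_fract r))}"

definition rat_const :: "rat \<Rightarrow> ratfun alg_closure" where
  "rat_const q = to_ac (to_fract [:q:])"

definition adjoin_root :: "ratfun alg_closure \<Rightarrow> ratfun alg_closure set" where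
  "adjoin_root x = generate_field ring_of_type_algebra (insert x (range to_ac))"

definition place_above_infinity :: "ratfun alg_closure \<Rightarrow> ratfun alg_closure set \<Rightarrow> bool" where
  "place_above_infinity x V \<longleftrightarrow>
     is_place (range rat_const) (adjoin_root x) V \<and> to_ac -` V = infinity_ring"

text \<open>The residue field is \<open>\<rat>\<close> in the sense that the canonical embedding of \<open>\<rat>\<close>
  is onto.\<close>

definition rational_place :: "ratfun alg_closure set \<Rightarrow> bool" where
  "rational_place V \<longleftrightarrow>
     carrier (residue_field V) =
       range (\<lambda>q. place_ideal V +>\<^bsub>ring_of_type_algebra\<lparr>carrier := V\<rparr>\<^esub> rat_const q)"

definition unramified_place :: "ratfun alg_closure \<Rightarrow> ratfun alg_closure set \<Rightarrow> bool" where
  "unramified_place x V \<longleftrightarrow> ramification_index (range to_ac) (adjoin_root x) V = 1"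

end

theory Submission
  imports Defs "Jordan_Normal_Form.Char_Poly"
begin

text \<open>
  The argument is of Runge type. Write \<open>F\<close> for a multiple of \<open>f\<close> in \<open>\<int>[t][X]\<close> and
  \<open>n\<close> for its degree. At a rational unramified place \<open>1/t\<close> is a uniformizer, so \<open>x\<close> has a Laurent
  expansion in \<open>1/t\<close> with rational coefficients; its truncations are Laurent polynomials \<open>w(t)\<close> with
  \<open>F(t, w(t))\<close> of arbitrarily large negative degree. Linear algebra gives \<open>P \<noteq> 0\<close> in
  \<open>\<int>[t][X]\<close> of degree less than \<open>n\<close> in \<open>X\<close> and at most \<open>D\<close> in \<open>t\<close> with
  \<open>P(t, w(t)) = O(t\<^sup>-\<^sup>N)\<close> for \<open>N\<close> close to \<open>(n - 1) D\<close>.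

  For a large integer \<open>c\<close> the polynomial \<open>F(c, X)\<close> has a complex root \<open>y\<close> very close to \<open>w(c)\<close>,
  so that \<open>P(c, y) = O(c\<^sup>-\<^sup>N)\<close>. If \<open>F(c, X)\<close> is reducible, then \<open>y\<close> is a root of a factor
  \<open>g\<close> with integer coefficients and degree \<open>m < n\<close>. In the resultant of \<open>g\<close> and \<open>P(c, X)\<close> the
  small value at \<open>y\<close> outweighs the other \<open>m - 1 \<le> n - 2\<close> factors of size about \<open>c\<^sup>D\<close>, so this
  integer vanishes. But \<open>F\<close> and \<open>P\<close> are coprime over \<open>\<rat>(t)\<close>, which allows this for
  only finitely many \<open>c\<close>.
\<close>

subsection \<open>Places above infinity\<close>

text \<open>Two representations of a nonzero fraction satisfy p b = a q, hence have the same
  difference of degrees; the test on lowest terms may be made on any representation.\<close>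

lemma infinity_ring_Fract:
  assumes "b \<noteq> 0"
  shows "Fract a b \<in> infinity_ring \<longleftrightarrow> degree a \<le> degree b"
proof -
  define r where "r = Fract a b"
  obtain p q where pq: "quot_of_fract r = (p, q)" by fastforce
  have q: "q \<noteq> 0" using snd_quot_of_fract_nonzero[of r] pq by simp
  have "Fract p q = Fract a b" using Fract_quot_of_fract[of r] pq by (metis fst_conv snd_conv r_def)
  then have eq: "p * b = a * q" using q assms by (simp add: eq_fract)
  show ?thesis
  proof (cases "a = 0")
    case True
    then show ?thesis using eq q assms pq by (simp add: infinity_ring_def r_def)
  next
    case False
    then have "p \<noteq> 0" using eq q by auto
    then have "degree p + degree b = degree a + degree q"
      using eq assms q False by (metis degree_mult_eq)
    then show ?thesis using pq by (auto simp: infinity_ring_def r_def)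
  qed
qed

definition tvar :: "ratfun alg_closure" where
  "tvar = to_ac (to_fract [:0, 1:])"

lemma tvar_nonzero: "tvar \<noteq> 0"
  by (simp add: tvar_def)

lemma tvar_power: "tvar ^ k = to_ac (to_fract (monom 1 k))"
proof -
  have "to_fract (p ^ j) = to_fract p ^ j" for p :: "rat poly" and j
    by (induction j) simp_all
  then show ?thesis
    by (simp add: tvar_def monom_altdef)
qed

text \<open>A function vanishing at infinity has a denominator of strictly larger degree, so one
  factor t keeps it finite: 1/t is a uniformizer of Q(t) at infinity.\<close>

lemma proper_fract_times_var:
  assumes "inverse r \<notin> infinity_ring" "r \<noteq> 0"
  shows "to_fract [:0, 1:] * r \<in> infinity_ring"
proof -
  obtain a b where ab: "r = Fract a b" "b \<noteq> 0"
    using Fract_cases by blast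
  have "a \<noteq> 0" using assms(2) ab by (auto simp: fract_collapse)
  then have "degree a < degree b"
    using assms(1) infinity_ring_Fract[of a b] ab by (simp add: not_le)
  moreover have "to_fract [:0, 1:] * r = Fract ([:0,1:] * a) b"
    by (simp add: ab to_fract_def)
  ultimately show ?thesis
    using infinity_ring_Fract[OF ab(2), of "[:0,1:] * a"] \<open>a \<noteq> 0\<close>
    by (simp add: degree_mult_eq)
qed

section \<open>Rational and unramified places\<close>

lemma subring_of_typeD:
  fixes V :: "'a::field set"
  assumes "subring V ring_of_type_algebra"
  shows "0 \<in> V" "1 \<in> V" "\<And>a b. a \<in> V \<Longrightarrow> b \<in> V \<Longrightarrow> a + b \<in> V"
    "\<And>a b. a \<in> V \<Longrightarrow> b \<in> V \<Longrightarrow> a * b \<in> V" "\<And>a. a \<in> V \<Longrightarrow> - a \<in> V"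
    "\<And>a b. a \<in> V \<Longrightarrow> b \<in> V \<Longrightarrow> a - b \<in> V"
proof -
  interpret R: ring "ring_of_type_algebra :: 'a ring" by (rule ring_from_type_algebra)
  note sr = subringE[OF assms]
  show "0 \<in> V" "1 \<in> V" using sr(2,3) by (simp_all add: ring_of_type_algebra_def)
  show add: "\<And>a b. a \<in> V \<Longrightarrow> b \<in> V \<Longrightarrow> a + b \<in> V"
    using sr(7) by (simp add: ring_of_type_algebra_def)
  show "\<And>a b. a \<in> V \<Longrightarrow> b \<in> V \<Longrightarrow> a * b \<in> V"
    using sr(6) by (simp add: ring_of_type_algebra_def)
  show minus: "- a \<in> V" if "a \<in> V" for a
  proof -
    have "\<ominus>\<^bsub>ring_of_type_algebra\<^esub> a \<in> V" using sr(5) that by simp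
    moreover have "\<ominus>\<^bsub>ring_of_type_algebra\<^esub> a = - a"
      by (rule R.minus_equality) (simp_all add: ring_of_type_algebra_def)
    ultimately show ?thesis by simp
  qed
  show "\<And>a b. a \<in> V \<Longrightarrow> b \<in> V \<Longrightarrow> a - b \<in> V"
    using add minus by (metis diff_conv_add_uminus)
qed

text \<open>Supplies the next coefficient of a Laurent expansion: the coset of \<open>z\<close> is
  that of a rational constant, and \<open>z\<close> lies in its own coset.\<close>

lemma rational_place_residue:
  assumes "subring V ring_of_type_algebra" "rational_place V" "z \<in> V"
  shows "\<exists>q. z - rat_const q \<in> place_ideal V"
proof -
  define S where "S = (ring_of_type_algebra :: ratfun alg_closure ring)\<lparr>carrier := V\<rparr>"
  note V = subring_of_typeD[OF assms(1)]
  have "place_ideal V +>\<^bsub>S\<^esub> z \<in> carrier (residue_field V)"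
    using assms(3) by (auto simp: residue_field_def FactRing_def A_RCOSETS_def'  S_def)
  then obtain q where q: "place_ideal V +>\<^bsub>S\<^esub> z = place_ideal V +>\<^bsub>S\<^esub> rat_const q"
    using assms(2) unfolding rational_place_def S_def by auto
  have coset: "place_ideal V +>\<^bsub>S\<^esub> w = (\<lambda>h. h + w) ` place_ideal V" for w
    by (auto simp: S_def a_r_coset_def' ring_of_type_algebra_def)
  have "0 \<in> place_ideal V" using V(1) by (simp add: place_ideal_def)
  then have "z \<in> place_ideal V +>\<^bsub>S\<^esub> z" unfolding coset by force
  then obtain h where "h \<in> place_ideal V" "z = h + rat_const q" unfolding q unfolding coset by blast
  then show ?thesis by (metis add_diff_cancel_right')
qed

text \<open>With a single coset the translates of \<open>H\<close> by \<open>z\<close> and by 1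
  agree, and \<open>z\<close>, being 1 times \<open>z\<close>, lies in the first.\<close>

lemma card_rcosets_1_imp_mem:
  assumes "group G" "card (rcosets\<^bsub>G\<^esub> H) = 1" "\<one>\<^bsub>G\<^esub> \<in> H" "H \<subseteq> carrier G" "z \<in> carrier G"
  shows "z \<in> H"
proof -
  interpret group G by fact
  obtain C where C: "rcosets\<^bsub>G\<^esub> H = {C}" using assms(2) by (rule card_1_singletonE)
  have "H #>\<^bsub>G\<^esub> z = H #>\<^bsub>G\<^esub> \<one>\<^bsub>G\<^esub>"
    using C assms(5) one_closed unfolding RCOSETS_def by (metis (no_types, lifting) UN_I insertI1 singletonD)
  also have "\<dots> = H" using assms(4) by simp
  finally show ?thesis using assms(3,5)  by (force simp: r_coset_def)
qed

text \<open>Index one means that the units of Q(t) and of \<open>V\<close> together fill the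
  multiplicative group of Q(t, x): every nonzero element has the value of some rational function
  \<open>r\<close>, up to a unit \<open>u\<close> of \<open>V\<close>.\<close>

lemma unramified_place_factor:
  assumes V: "place_above_infinity x V" and unr: "unramified_place x V"
    and z: "z \<in> adjoin_root x" "z \<noteq> 0"
  shows "\<exists>r u. r \<noteq> 0 \<and> u \<in> V \<and> inverse u \<in> V \<and> u \<noteq> 0 \<and> z = to_ac r * u"
proof -
  define R where "R = (ring_of_type_algebra :: ratfun alg_closure ring)"
  define K where "K = adjoin_root x"
  define F where "F = range (to_ac :: ratfun \<Rightarrow> _)"
  interpret R: field R unfolding R_def by (rule field_from_type_algebra)
  have R_simps: "carrier R = UNIV" "monoid.mult R = (*)" "one R = 1" "ring.zero R = 0"
    by (simp_all add: R_def ring_of_type_algebra_def)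
  have subK: "subfield K R"
    unfolding K_def adjoin_root_def R_def[symmetric] by (rule R.generate_field_is_subfield) (simp add: R_simps)
  have FK: "F \<subseteq> K"
    unfolding K_def F_def adjoin_root_def R_def[symmetric]
    by (auto intro: generate_field.incl)
  have VK: "V \<subseteq> K" using V by (auto simp: place_above_infinity_def is_place_def K_def)
  have sV: "subring V ring_of_type_algebra" using V by (simp add: place_above_infinity_def is_place_def)
  interpret K: field "R\<lparr>carrier := K\<rparr>" by (rule R.subfield_iff(2)[OF subK])
  have UK: "Units (R\<lparr>carrier := K\<rparr>) = K - {0}"
    using K.field_Units by (simp add: R_simps)
  define G where "G = units_of (R\<lparr>carrier := K\<rparr>)"
  have G: "group G" unfolding G_def by (rule K.units_group)
  have G_simps: "carrier G = K - {0}" "monoid.mult G = (*)" "one G = 1"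
    using UK by (simp_all add: G_def units_of_def R_simps)
  define H where "H = Units (R\<lparr>carrier := F\<rparr>) <#>\<^bsub>G\<^esub> Units (R\<lparr>carrier := V\<rparr>)"
  have UF: "a \<in> F \<and> a \<noteq> 0" if "a \<in> Units (R\<lparr>carrier := F\<rparr>)" for a
    using that by (auto simp: Units_def R_simps)
  have UV: "a \<in> V \<and> a \<noteq> 0 \<and> inverse a \<in> V" if a: "a \<in> Units (R\<lparr>carrier := V\<rparr>)" for a
  proof -
    obtain b where "a \<in> V" "b \<in> V" "a * b = 1" using a R_simps by (simp add: Units_def) metis
    moreover have "inverse a = b" using \<open>a * b = 1\<close> by (rule inverse_unique)
    moreover have "a \<noteq> 0" using \<open>a * b = 1\<close> by auto
    ultimately show ?thesis by simp
  qed
  have mult_K: "a * b \<in> K" if "a \<in> K" "b \<in> K" for a b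
    using K.m_closed[of a b] that by (simp add: R_simps)
  have memH: "a \<in> H \<longleftrightarrow> (\<exists>f\<in>Units (R\<lparr>carrier := F\<rparr>). \<exists>v\<in>Units (R\<lparr>carrier := V\<rparr>). a = f * v)" for a
    by (auto simp: H_def set_mult_def G_simps)
  have "card (rcosets\<^bsub>G\<^esub> H) = 1"
    using unr by (simp add: unramified_place_def ramification_index_def Let_def H_def G_def K_def F_def R_def)
  moreover have "\<one>\<^bsub>G\<^esub> \<in> H"
  proof -
    have "1 \<in> F" unfolding F_def by (metis rangeI to_ac_1)
    then have "1 \<in> Units (R\<lparr>carrier := F\<rparr>)" by (simp add: Units_def R_simps)
    moreover have "1 \<in> Units (R\<lparr>carrier := V\<rparr>)"
      using subring_of_typeD(2)[OF sV] by (simp add: Units_def R_simps)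
    ultimately show ?thesis unfolding memH G_simps by (intro bexI[of _ 1]) auto
  qed
  moreover have "H \<subseteq> carrier G"
  proof
    fix a assume "a \<in> H"
    then obtain f v where fv: "f \<in> Units (R\<lparr>carrier := F\<rparr>)" "v \<in> Units (R\<lparr>carrier := V\<rparr>)" "a = f * v"
      unfolding memH by blast
    moreover have "f \<in> K" "f \<noteq> 0" using UF[OF fv(1)] FK by auto
    moreover have "v \<in> K" "v \<noteq> 0" using UV[OF fv(2)] VK by auto
    ultimately show "a \<in> carrier G" using mult_K unfolding G_simps by simp
  qed
  moreover have "z \<in> carrier G" using z by (simp add: G_simps K_def)
  ultimately have "z \<in> H" using card_rcosets_1_imp_mem[OF G] by blast
  then obtain f v where fv: "f \<in> Units (R\<lparr>carrier := F\<rparr>)" "v \<in> Units (R\<lparr>carrier := V\<rparr>)" "z = f * v"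
    unfolding memH by blast
  obtain r where "f = to_ac r" "r \<noteq> 0" using UF[OF fv(1)] unfolding F_def by auto
  then show ?thesis using UV[OF fv(2)] fv(3) by blast
qed

lemma to_ac_mem_place_iff:
  assumes "place_above_infinity x V"
  shows "to_ac r \<in> V \<longleftrightarrow> r \<in> infinity_ring"
  using assms by (auto simp: place_above_infinity_def)

text \<open>The uniformizer 1/t of Q(t) remains one for \<open>V\<close>. In z = r u with a unit u,
  the function r vanishes at infinity, since otherwise 1/z would lie in \<open>V\<close>; hence t r
  is finite.\<close>

lemma place_ideal_times_var:
  assumes V: "place_above_infinity x V" and unr: "unramified_place x V"
    and z: "z \<in> place_ideal V"
  shows "tvar * z \<in> V"
proof (cases "z = 0")
  case True
  then show ?thesis using z by (simp add: place_ideal_def)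
next
  case False
  have sV: "subring V ring_of_type_algebra" using V by (simp add: place_above_infinity_def is_place_def)
  note VD = subring_of_typeD[OF sV]
  have "z \<in> adjoin_root x" "inverse z \<notin> V"
    using z V False by (auto simp: place_ideal_def place_above_infinity_def is_place_def)
  then obtain r u where ru: "r \<noteq> 0" "u \<in> V" "inverse u \<in> V" "u \<noteq> 0" "z = to_ac r * u"
    using unramified_place_factor[OF V unr _ False] by blast
  have "inverse z = to_ac (inverse r) * inverse u" by (simp add: ru)
  then have "to_ac (inverse r) \<notin> V" using VD(4) \<open>inverse z \<notin> V\<close> ru(3) by metis
  then have "inverse r \<notin> infinity_ring" using to_ac_mem_place_iff[OF V] by blast
  then have "to_ac (to_fract [:0, 1:] * r) \<in> V"
    using proper_fract_times_var ru(1) to_ac_mem_place_iff[OF V] by blast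
  then have "to_ac (to_fract [:0, 1:] * r) * u \<in> V" using VD(4) ru(2) by blast
  then show ?thesis by (simp add: ru(5) tvar_def mult.assoc)
qed

text \<open>\<open>G\<close> is t^M times the expansion of \<open>z\<close> in 1/t, cut off before
  the term t^-M. Each step takes the residue of the remainder as the next coefficient; the
  difference lies in the maximal ideal and may be multiplied by t.\<close>

lemma place_laurent_expansion:
  assumes V: "place_above_infinity x V" and rat: "rational_place V" and unr: "unramified_place x V"
    and z: "z \<in> V"
  shows "\<exists>G. degree G \<le> M \<and> tvar ^ M * z - to_ac (to_fract G) \<in> V"
proof (induction M)
  case 0
  then show ?case using z by (intro exI[of _ 0]) simp
next
  case (Suc M)
  have sV: "subring V ring_of_type_algebra" using V by (simp add: place_above_infinity_def is_place_def)
  obtain G where G: "degree G \<le> M" "tvar ^ M * z - to_ac (to_fract G) \<in> V"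
    using Suc by blast
  obtain q where "tvar ^ M * z - to_ac (to_fract G) - rat_const q \<in> place_ideal V"
    using rational_place_residue[OF sV rat G(2)] by blast
  then have "tvar * (tvar ^ M * z - to_ac (to_fract G) - rat_const q) \<in> V"
    by (rule place_ideal_times_var[OF V unr])
  moreover have "tvar * (tvar ^ M * z - to_ac (to_fract G) - rat_const q) =
      tvar ^ Suc M * z - to_ac (to_fract ([:0, 1:] * (G + [:q:])))"
    unfolding tvar_def rat_const_def to_fract_mult to_fract_add to_ac_mult to_ac_add
    by (simp add: algebra_simps del: mult_pCons_left mult_pCons_right)
  moreover have "degree ([:0, 1:] * (G + [:q:])) \<le> Suc M"
    using G(1) by (intro order.trans[OF degree_mult_le]) (simp add: degree_add_le)
  ultimately show ?case by (metis)
qed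

lemma place_pole_order:
  assumes V: "place_above_infinity x V" and unr: "unramified_place x V"
  shows "\<exists>k. \<exists>w\<in>V. x = tvar ^ k * w"
proof (cases "x = 0")
  case True
  have sV: "subring V ring_of_type_algebra" using V by (simp add: place_above_infinity_def is_place_def)
  show ?thesis using subring_of_typeD(1)[OF sV] True by (intro exI[of _ 0]) auto
next
  case False
  have sV: "subring V ring_of_type_algebra" using V by (simp add: place_above_infinity_def is_place_def)
  note VD = subring_of_typeD[OF sV]
  have "x \<in> adjoin_root x" unfolding adjoin_root_def by (auto intro: generate_field.incl)
  then obtain r u where ru: "r \<noteq> 0" "u \<in> V" "x = to_ac r * u"
    using unramified_place_factor[OF V unr _ False] by blast
  obtain a b where ab: "r = Fract a b" "b \<noteq> 0"
    using Fract_cases by blast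
  \<comment> \<open>A crude bound for the pole order: whatever the degree of \<open>b\<close>, the
    denominator b t^k has at least the degree of \<open>a\<close>.\<close>
  define k where "k = degree a"
  define s where "s = Fract a (b * monom 1 k)"
  have "to_ac s \<in> V"
    using ab(2) unfolding to_ac_mem_place_iff[OF V] s_def
    by (subst infinity_ring_Fract) (auto simp: degree_mult_eq degree_monom_eq k_def)
  then have "to_ac s * u \<in> V" using VD(4) ru(2) by blast
  moreover have "r = to_fract (monom 1 k) * s"
    using ab(2) by (simp add: ab s_def to_fract_def eq_fract)
  then have "x = tvar ^ k * (to_ac s * u)"
    by (simp add: ru(3) tvar_power mult.assoc)
  ultimately show ?thesis by blast
qed

section \<open>From the place to Laurent polynomials as approximate roots\<close>

lemma power_diff_factor_in_ring:
  fixes V :: "'a::field set"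
  assumes "subring V ring_of_type_algebra" "a \<in> V" "b \<in> V"
  shows "\<exists>s\<in>V. a ^ i - b ^ i = (a - b) * s"
proof (induction i)
  case 0
  then show ?case using subring_of_typeD(1)[OF assms(1)] by auto
next
  case (Suc i)
  note VD = subring_of_typeD[OF assms(1)]
  obtain s where s: "s \<in> V" "a ^ i - b ^ i = (a - b) * s" using Suc by blast
  have pw: "b ^ j \<in> V" for j by (induction j) (use VD assms in auto)
  have "a ^ Suc i - b ^ Suc i = a * (a ^ i - b ^ i) + (a - b) * b ^ i" by (simp add: algebra_simps)
  also have "\<dots> = (a - b) * (a * s + b ^ i)" by (simp add: s algebra_simps)
  finally show ?case using VD(3,4) s(1) assms pw by blast
qed

text \<open>The sum is t^(M n) F(t, t^k G/t^M). Since G/t^M differs from x/t^k by O(t^-M) and F(t,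
  x) = 0, the value of F at the approximation is O(t^(e - M)) with \<open>e\<close> independent of
  \<open>M\<close>. The factor t^(M n) keeps everything polynomial.\<close>

lemma place_approximate_root:
  fixes F :: "rat poly poly"
  assumes V: "place_above_infinity x V" and rat: "rational_place V" and unr: "unramified_place x V"
    and root: "poly (map_poly (\<lambda>a. to_ac (to_fract a)) F) x = 0"
    and n: "n = degree F" "n > 0"
  shows "\<exists>k e. \<forall>M. \<exists>G. degree G \<le> M \<and>
    degree (\<Sum>i\<le>n. coeff F i * monom 1 (k * i + M * (n - i)) * G ^ i) + M \<le> M * n + e"
proof -
  have sV: "subring V ring_of_type_algebra" using V by (simp add: place_above_infinity_def is_place_def)
  note VD = subring_of_typeD[OF sV]
  define \<iota> :: "rat poly \<Rightarrow> ratfun alg_closure" where "\<iota> = (\<lambda>a. to_ac (to_fract a))"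
  have \<iota>_mult: "\<iota> (a * b) = \<iota> a * \<iota> b" and \<iota>_add: "\<iota> (a + b) = \<iota> a + \<iota> b" and \<iota>_0: "\<iota> 0 = 0" and \<iota>_1: "\<iota> 1 = 1"
    for a b by (simp_all add: \<iota>_def)
  have \<iota>_power: "\<iota> (a ^ j) = \<iota> a ^ j" for a j by (induction j) (simp_all add: \<iota>_mult \<iota>_1)
  have \<iota>_sum: "\<iota> (sum f A) = (\<Sum>i\<in>A. \<iota> (f i))" for f and A :: "nat set"
    by (induction A rule: infinite_finite_induct) (simp_all add: \<iota>_add \<iota>_0)
  have \<iota>_monom: "\<iota> (monom 1 j) = tvar ^ j" for j by (simp add: \<iota>_def tvar_power)
  have \<iota>_div: "\<iota> a / \<iota> b = to_ac (Fract a b)" if "b \<noteq> 0" for a b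
    by (simp add: \<iota>_def to_fract_def flip: to_ac_divide)
  \<comment> \<open>The dictionary between membership in \<open>V\<close> and degrees, used in both
    directions.\<close>
  have \<iota>V: "\<iota> a / tvar ^ j \<in> V \<longleftrightarrow> degree a \<le> j" for a j
    using \<iota>_div[of "monom 1 j" a] infinity_ring_Fract[of "monom 1 j" a] to_ac_mem_place_iff[OF V]
    by (simp add: \<iota>_monom degree_monom_eq)
  obtain k w where w: "w \<in> V" "x = tvar ^ k * w" using place_pole_order[OF V unr] by blast
  \<comment> \<open>Any bound independent of \<open>M\<close> for the degrees of all F_i t^(k i)
    will do; the sum over all i is one.\<close>
  define e where "e = (\<Sum>i\<le>n. degree (coeff F i) + k * i)"
  have "\<exists>G. degree G \<le> M \<and>
    degree (\<Sum>i\<le>n. coeff F i * monom 1 (k * i + M * (n - i)) * G ^ i) + M \<le> M * n + e" for M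
  proof -
    obtain G where G: "degree G \<le> M" "tvar ^ M * w - \<iota> G \<in> V"
      using place_laurent_expansion[OF V rat unr w(1)] unfolding \<iota>_def by blast
    define w' where "w' = \<iota> G / tvar ^ M"
    define v where "v = tvar ^ M * w - \<iota> G"
    have w'V: "w' \<in> V" using \<iota>V G(1) by (simp add: w'_def)
    have v: "v = tvar ^ M * (w - w')" using tvar_nonzero by (simp add: v_def w'_def field_simps)
    define B where "B = (\<Sum>i\<le>n. coeff F i * monom 1 (k * i + M * (n - i)) * G ^ i)"
    have F0: "(\<Sum>i\<le>n. \<iota> (coeff F i) * tvar ^ (k * i) * w ^ i) = 0"
    proof -
      have "degree (map_poly \<iota> F) = n"
        unfolding n by (rule degree_map_poly) (auto simp: \<iota>_def)
      then have "0 = (\<Sum>i\<le>n. \<iota> (coeff F i) * x ^ i)"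
        using root unfolding \<iota>_def[symmetric] poly_altdef
        by (simp add: coeff_map_poly \<iota>_0)
      then show ?thesis by (simp add: w(2) power_mult_distrib power_mult mult.assoc)
    qed
    have "\<iota> B / tvar ^ (M * n) = (\<Sum>i\<le>n. \<iota> (coeff F i) * tvar ^ (k * i) * w' ^ i)"
      unfolding B_def \<iota>_sum sum_divide_distrib
    proof (rule sum.cong)
      fix i assume "i \<in> {..n}"
      then have "M * n = M * (n - i) + M * i" by (simp flip: distrib_left)
      then show "\<iota> (coeff F i * monom 1 (k * i + M * (n - i)) * G ^ i) / tvar ^ (M * n) =
        \<iota> (coeff F i) * tvar ^ (k * i) * w' ^ i"
        using tvar_nonzero
        by (simp add: \<iota>_mult \<iota>_power \<iota>_monom w'_def power_add power_divide power_mult)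
    qed simp
    \<comment> \<open>Subtracting F(t, x) = 0 leaves differences of powers, each divisible in
      \<open>V\<close> by w' - w.\<close>
    also have "\<dots> = (\<Sum>i\<le>n. \<iota> (coeff F i) * tvar ^ (k * i) * (w' ^ i - w ^ i))"
      using F0 by (simp add: right_diff_distrib sum_subtractf)
    finally have B: "tvar ^ M * (\<iota> B / tvar ^ (M * n)) / tvar ^ e =
      (\<Sum>i\<le>n. tvar ^ M * (\<iota> (coeff F i) * tvar ^ (k * i) * (w' ^ i - w ^ i)) / tvar ^ e)"
      by (simp add: sum_distrib_left sum_divide_distrib)
    have term_V: "tvar ^ M * (\<iota> (coeff F i) * tvar ^ (k * i) * (w' ^ i - w ^ i)) / tvar ^ e \<in> V"
      if "i \<in> {..n}" for i
    proof -
      obtain s where s: "s \<in> V" "w' ^ i - w ^ i = (w' - w) * s"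
        using power_diff_factor_in_ring[OF sV w'V w(1)] by blast
      have "degree (coeff F i) + k * i \<le> e"
        unfolding e_def using that by (intro member_le_sum) auto
      then have e1: "\<iota> (coeff F i * monom 1 (k * i)) / tvar ^ e \<in> V"
        unfolding \<iota>V by (intro order.trans[OF degree_mult_le]) (simp add: degree_monom_eq)
      have e2: "tvar ^ M * (\<iota> (coeff F i) * tvar ^ (k * i) * (w' ^ i - w ^ i)) / tvar ^ e =
        \<iota> (coeff F i * monom 1 (k * i)) / tvar ^ e * (tvar ^ M * (w' - w)) * s"
        by (simp add: s \<iota>_mult \<iota>_monom divide_inverse mult.assoc mult.left_commute)
      have e3: "tvar ^ M * (w' - w) = - v" by (simp add: v algebra_simps)
      have "v \<in> V" using G(2) by (simp add: v_def)
      then have "- v \<in> V" by (rule VD(5))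
      then show ?thesis unfolding e2 e3 by (intro VD(4)[OF VD(4)[OF e1] s(1)])
    qed
    have sum_V: "sum f A \<in> V" if "\<And>i. i \<in> A \<Longrightarrow> f i \<in> V" for f and A :: "nat set"
      using that by (induction A rule: infinite_finite_induct) (auto intro: VD)
    have "tvar ^ M * (\<iota> B / tvar ^ (M * n)) / tvar ^ e \<in> V"
      unfolding B by (rule sum_V) (rule term_V)
    then have "\<iota> (monom 1 M * B) / tvar ^ (M * n + e) \<in> V"
      by (simp add: \<iota>_mult \<iota>_monom power_add)
    then have "degree (monom 1 M * B) \<le> M * n + e" unfolding \<iota>V .
    \<comment> \<open>For \<open>B\<close> = 0 the product has degree 0, which says nothing about
      \<open>M\<close>; this inequality settles that case.\<close>
    moreover have "M \<le> M * n" using n(2) by simp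
    ultimately have "degree B + M \<le> M * n + e"
      by (cases "B = 0") (auto simp: degree_mult_eq degree_monom_eq intro: le_SucI trans_le_add1)
    then show ?thesis using G(1) unfolding B_def by blast
  qed
  then show ?thesis by blast
qed

subsection \<open>A lower bound for values of integer polynomials\<close>

text \<open>Every product in the Leibniz expansion takes one entry from each row and each column, so
  each weight occurs exactly once in its bound, whatever the permutation.\<close>

lemma cmod_det_le:
  fixes A :: "complex mat"
  assumes A: "A \<in> carrier_mat n n"
    and le: "\<And>i j. i < n \<Longrightarrow> j < n \<Longrightarrow> cmod (A $$ (i, j)) \<le> r i * c j"
  shows "cmod (det A) \<le> fact n * ((\<Prod>i<n. r i) * (\<Prod>j<n. c j))"
proof -
  have "cmod (det A) \<le> (\<Sum>p | p permutes {0..<n}. (\<Prod>i<n. r i) * (\<Prod>j<n. c j))"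
    unfolding det_def'[OF A]
  proof (rule sum_norm_le)
    fix p assume "p \<in> {p. p permutes {0..<n}}"
    then have p: "p permutes {..<n}" by (simp add: atLeast0LessThan)
    have "cmod (signof p * (\<Prod>i = 0..<n. A $$ (i, p i))) = (\<Prod>i<n. cmod (A $$ (i, p i)))"
      by (simp add: norm_mult prod_norm sign_def atLeast0LessThan)
    also have "\<dots> \<le> (\<Prod>i<n. r i * c (p i))"
      using le permutes_in_image[OF p] by (intro prod_mono) auto
    also have "\<dots> = (\<Prod>i<n. r i) * (\<Prod>i<n. c (p i))" by (rule prod.distrib)
    also have "(\<Prod>i<n. c (p i)) = (\<Prod>j<n. c j)"
      using prod.permute[OF p, of c] by (simp add: comp_def)
    finally show "cmod (signof p * (\<Prod>i = 0..<n. A $$ (i, p i))) \<le> (\<Prod>i<n. r i) * (\<Prod>j<n. c j)" .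
  qed
  also have "\<dots> = fact n * ((\<Prod>i<n. r i) * (\<Prod>j<n. c j))"
    by (simp add: card_permutations)
  finally show ?thesis .
qed

section \<open>Resultants through a Sylvester matrix\<close>

lemma sum_lessThan_add:
  fixes f :: "nat \<Rightarrow> 'a::comm_monoid_add"
  shows "(\<Sum>i<d + m. f i) = (\<Sum>i<d. f i) + (\<Sum>i<m. f (d + i))"
  by (induction m) (simp_all add: add.assoc)

lemma prod_lessThan_add:
  fixes f :: "nat \<Rightarrow> 'a::comm_monoid_mult"
  shows "(\<Prod>i<d + m. f i) = (\<Prod>i<d. f i) * (\<Prod>i<m. f (d + i))"
  by (induction m) (simp_all add: mult.assoc)

text \<open>A Sylvester matrix in which \<open>d\<close> is only an upper bound for the degree of \<open>P\<close>, with
  columns ordered by increasing powers.\<close>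

definition sylvester_block :: "'a::comm_ring_1 poly \<Rightarrow> 'a poly \<Rightarrow> nat \<Rightarrow> nat \<Rightarrow> 'a mat" where
  "sylvester_block g P m d = mat (m + d) (m + d) (\<lambda>(i, j).
     if i < d then coeff (monom 1 i * g) j else coeff (monom 1 (i - d) * P) j)"

text \<open>A kernel vector of the transpose is a pair a, b of degrees below d and m with a g + b P
  = 0. Multiplying the Bezout identity by b shows that g divides r b; by degrees b = 0, and then a =
  0.\<close>

lemma det_sylvester_block_nonzero:
  fixes g P A B :: "int poly"
  assumes g: "degree g = m" "m > 0" and P: "degree P \<le> d"
    and bez: "A * g + B * P = [:r:]" "r \<noteq> 0"
  shows "det (sylvester_block g P m d) \<noteq> 0"
proof
  assume "det (sylvester_block g P m d) = 0"
  define N where "N = m + d"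
  have S: "sylvester_block g P m d \<in> carrier_mat N N" by (simp add: sylvester_block_def N_def)
  have "det (transpose_mat (sylvester_block g P m d)) = 0"
    using det_transpose[OF S] \<open>det _ = 0\<close> by simp
  then obtain v where v: "v \<in> carrier_vec N" "v \<noteq> 0\<^sub>v N" "transpose_mat (sylvester_block g P m d) *\<^sub>v v = 0\<^sub>v N"
    using det_0_iff_vec_prod_zero[of "transpose_mat (sylvester_block g P m d)" N] S by auto
  define a where "a = (\<Sum>i<d. monom (v $ i) i)"
  define b where "b = (\<Sum>i<m. monom (v $ (d + i)) i)"
  have coeff_a: "coeff a i = (if i < d then v $ i else 0)" for i
    by (simp add: a_def coeff_sum)
  have coeff_b: "coeff b i = (if i < m then v $ (d + i) else 0)" for i
    by (simp add: b_def coeff_sum)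
  have smult_monom_one: "monom c i * q = smult c (monom 1 i * q)" for c i and q :: "int poly"
    by (simp flip: mult_smult_left add: smult_monom)
  have eq: "a * g + b * P = (\<Sum>i<d. smult (v $ i) (monom 1 i * g)) + (\<Sum>i<m. smult (v $ (d + i)) (monom 1 i * P))"
    unfolding a_def b_def sum_distrib_right by (subst (1 2) smult_monom_one) simp
  have "a * g + b * P = 0"
  proof (rule poly_eqI)
    fix j
    show "coeff (a * g + b * P) j = coeff 0 j"
    proof (cases "j < N")
      case True
      have "0 = (transpose_mat (sylvester_block g P m d) *\<^sub>v v) $ j" using v(3) True by simp
      also have "\<dots> = (\<Sum>i<N. sylvester_block g P m d $$ (i, j) * v $ i)"
        using True S v(1) by (simp add: scalar_prod_def atLeast0LessThan)
      also have "\<dots> = (\<Sum>i<d. sylvester_block g P m d $$ (i, j) * v $ i) + (\<Sum>i<m. sylvester_block g P m d $$ (d + i, j) * v $ (d + i))"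
        unfolding N_def add.commute[of m d] by (rule sum_lessThan_add)
      also have "(\<Sum>i<d. sylvester_block g P m d $$ (i, j) * v $ i) = (\<Sum>i<d. v $ i * coeff (monom 1 i * g) j)"
        using True by (intro sum.cong) (auto simp: sylvester_block_def N_def)
      also have "(\<Sum>i<m. sylvester_block g P m d $$ (d + i, j) * v $ (d + i)) = (\<Sum>i<m. v $ (d + i) * coeff (monom 1 i * P) j)"
        using True by (intro sum.cong) (auto simp: sylvester_block_def N_def)
      finally show ?thesis unfolding eq by (simp add: coeff_sum)
    next
      case False
      have "coeff (monom 1 i * g) j = 0" if "i < d" for i
        using False that g by (simp add: coeff_monom_mult coeff_eq_0 N_def)
      moreover have "coeff (monom 1 i * P) j = 0" if "i < m" for i
        using False that P by (simp add: coeff_monom_mult coeff_eq_0 N_def)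
      ultimately show ?thesis unfolding eq by (simp add: coeff_sum)
    qed
  qed
  then have bP: "b * P = - (a * g)" by (simp add: eq_neg_iff_add_eq_0 add.commute)
  have "smult r b = b * (A * g + B * P)" by (simp add: bez)
  also have "\<dots> = g * (b * A) + B * (b * P)" by (simp add: algebra_simps)
  also have "\<dots> = g * (b * A - B * a)" unfolding bP by (simp add: algebra_simps)
  finally have dvd: "g dvd smult r b" by simp
  have "b = 0"
  proof (rule ccontr)
    assume "b \<noteq> 0"
    then have "degree b < m"
      using coeff_b leading_coeff_0_iff by (metis)
    moreover have "m \<le> degree (smult r b)"
      using dvd_imp_degree_le[OF dvd] \<open>b \<noteq> 0\<close> bez(2) g(1) by simp
    ultimately show False using bez(2) by simp
  qed
  moreover have "a = 0" using bP \<open>b = 0\<close> g by auto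
  ultimately have "v $ i = 0" if "i < N" for i
    using coeff_a[of i] coeff_b[of "i - d"] that by (cases "i < d") (auto simp: N_def split: if_splits)
  then show False using v(1,2) by auto
qed

text \<open>The determinant is a nonzero integer, so its absolute value is at least 1. On the vector
  of powers of y the rows of g give 0, because g(y) = 0, and those of P give multiples of P(y). The
  upper bound thus gains the factor |P(y)| and loses one of the m factors \<open>H\<close>.\<close>

lemma resultant_lower_bound:
  fixes g P A B :: "int poly" and y :: complex
  assumes g: "degree g = m" "m > 0" and P: "degree P \<le> d"
    and bez: "A * g + B * P = [:r:]" "r \<noteq> 0"
    and y: "poly (map_poly of_int g) y = 0"
    and h: "\<And>i. \<bar>real_of_int (coeff g i)\<bar> \<le> h" "h > 0"
    and H: "\<And>i. \<bar>real_of_int (coeff P i)\<bar> \<le> H" "H > 0"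
    and R: "cmod y \<le> R" "R \<ge> 1"
  shows "1 \<le> fact (m + d) * h ^ d * H ^ (m - 1) * R ^ m * cmod (poly (map_poly of_int P) y)"
proof -
  define N where "N = m + d"
  have N0: "N > 0" using g by (simp add: N_def)
  define \<epsilon> where "\<epsilon> = cmod (poly (map_poly of_int P) y)"
  define S where "S = map_mat complex_of_int (sylvester_block g P m d)"
  have S: "S \<in> carrier_mat N N" by (simp add: S_def sylvester_block_def N_def)
  define v where "v = vec N (\<lambda>j. y ^ j)"
  have v: "v \<in> carrier_vec N" by (simp add: v_def)
  have eval: "(\<Sum>j<N. complex_of_int (coeff q j) * y ^ j) = poly (map_poly of_int q) y"
    if "degree q < N" for q
  proof -
    have "poly (map_poly of_int q) y = (\<Sum>j\<le>degree q. complex_of_int (coeff q j) * y ^ j)"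
      unfolding poly_altdef by (simp add: coeff_map_poly degree_map_poly)
    also have "\<dots> = (\<Sum>j<N. complex_of_int (coeff q j) * y ^ j)"
      using that by (intro sum.mono_neutral_left) (auto simp: coeff_eq_0)
    finally show ?thesis by simp
  qed
  have shift: "poly (map_poly of_int (monom 1 i * q)) y = y ^ i * poly (map_poly of_int q) y"
    for i and q :: "int poly"
    by (simp add: of_int_poly_hom.hom_mult poly_monom map_poly_monom)
  have Sv: "(S *\<^sub>v v) $ i = (if i < d then 0 else y ^ (i - d) * poly (map_poly of_int P) y)" if "i < N" for i
  proof -
    have "(S *\<^sub>v v) $ i = (\<Sum>j<N. S $$ (i, j) * y ^ j)"
      using S that by (simp add: scalar_prod_def v_def atLeast0LessThan)
    also have "\<dots> = (\<Sum>j<N. complex_of_int (coeff (if i < d then monom 1 i * g else monom 1 (i - d) * P) j) * y ^ j)"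
      using that by (intro sum.cong) (auto simp: S_def sylvester_block_def N_def)
    also have "\<dots> = poly (map_poly of_int (if i < d then monom 1 i * g else monom 1 (i - d) * P)) y"
    proof (rule eval)
      show "degree (if i < d then monom 1 i * g else monom 1 (i - d) * P) < N"
        using that g P degree_mult_le[of "monom 1 i" g] degree_mult_le[of "monom 1 (i - d)" P]
        by (auto simp: N_def degree_monom_eq)
    qed
    finally show ?thesis using y by (simp add: shift)
  qed
  txt \<open>Replacing column \<open>0\<close> by \<open>S v\<close> keeps the determinant, since \<open>v\<close> has
    \<open>0\<close>-th entry \<open>1\<close>; the new column vanishes in the rows of \<open>g\<close>, so the column weight \<open>c 0\<close>
    only has to compensate the row weight \<open>H\<close>.\<close>
  define r where "r = (\<lambda>i. if i < d then h else H)"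
  define c where "c = (\<lambda>j::nat. if j = 0 then R ^ m * \<epsilon> / H else 1)"
  have "1 \<le> cmod (det S)"
  proof -
    have "det S = of_int (det (sylvester_block g P m d))" by (simp add: S_def)
    then have "cmod (det S) = \<bar>real_of_int (det (sylvester_block g P m d))\<bar>" by simp
    then show ?thesis using det_sylvester_block_nonzero[OF g P bez] by linarith
  qed
  also have "det S = det (replace_col S (S *\<^sub>v v) 0)"
    using cramer_lemma_mat[OF S v N0] N0 by (simp add: v_def)
  also have "cmod \<dots> \<le> fact N * ((\<Prod>i<N. r i) * (\<Prod>j<N. c j))"
  proof (rule cmod_det_le)
    show "replace_col S (S *\<^sub>v v) 0 \<in> carrier_mat N N" using S by (auto simp: replace_col_def)
    fix i j assume ij: "i < N" "j < N"
    have "0 \<le> \<epsilon>" by (simp add: \<epsilon>_def)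
    show "cmod (replace_col S (S *\<^sub>v v) 0 $$ (i, j)) \<le> r i * c j"
    proof (cases "j = 0")
      case True
      show ?thesis
      proof (cases "i < d")
        case True
        then show ?thesis using ij S \<open>j = 0\<close> h(2) H(2) R(2) \<open>0 \<le> \<epsilon>\<close>
          by (auto simp: replace_col_def Sv r_def c_def simp del: index_mult_mat_vec)
      next
        case False
        have "cmod y ^ (i - d) \<le> R ^ (i - d)" using R(1) by (intro power_mono) auto
        also have "\<dots> \<le> R ^ m" using R(2) ij False by (intro power_increasing) (auto simp: N_def)
        finally have "cmod y ^ (i - d) * \<epsilon> \<le> R ^ m * \<epsilon>" using \<open>0 \<le> \<epsilon>\<close> by (rule mult_right_mono)
        then show ?thesis using False ij S \<open>j = 0\<close> H(2)
          by (auto simp: replace_col_def Sv r_def c_def norm_mult norm_power \<epsilon>_def simp del: index_mult_mat_vec)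
      qed
    next
      case False
      then have "replace_col S (S *\<^sub>v v) 0 $$ (i, j) = S $$ (i, j)"
        using ij S by (auto simp: replace_col_def)
      also have "cmod \<dots> \<le> r i"
        using ij h H by (auto simp: S_def sylvester_block_def N_def r_def coeff_monom_mult less_imp_le)
      finally show ?thesis using False by (simp add: c_def)
    qed
  qed
  also have "(\<Prod>i<N. r i) = h ^ d * H ^ m"
    unfolding N_def add.commute[of m d] prod_lessThan_add by (simp add: r_def)
  also have "(\<Prod>j<N. c j) = R ^ m * \<epsilon> / H"
    using N0 by (cases N) (simp_all add: c_def prod.lessThan_Suc_shift del: prod.lessThan_Suc)
  also have "h ^ d * H ^ m * (R ^ m * \<epsilon> / H) = h ^ d * H ^ (m - 1) * R ^ m * \<epsilon>"
    using g(2) H(2) by (cases m) (simp_all add: field_simps)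
  finally show ?thesis by (simp add: N_def \<epsilon>_def mult.assoc)
qed

subsection \<open>Factors and roots of integer polynomials\<close>

lemma of_int_poly_smult:
  "map_poly (of_int :: int \<Rightarrow> 'a::comm_ring_1) (smult c p) = smult (of_int c) (map_poly of_int p)"
  by (intro poly_eqI) (simp add: coeff_map_poly)

lemma map_poly_of_rat_smult:
  "map_poly (of_rat :: rat \<Rightarrow> 'a::field_char_0) (smult c p) = smult (of_rat c) (map_poly of_rat p)"
  by (intro poly_eqI) (simp add: coeff_map_poly of_rat_mult)

lemma clear_denominators_rat:
  fixes u :: "rat poly"
  shows "\<exists>k g. k \<noteq> 0 \<and> smult (of_int k) u = map_poly of_int (g :: int poly)"
proof (induction u)
  case 0
  show ?case by (intro exI[of _ 1] exI[of _ 0]) simp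
next
  case (pCons a u)
  obtain k g where kg: "k \<noteq> 0" "smult (of_int k) u = map_poly of_int (g :: int poly)"
    using pCons by blast
  obtain p q where pq: "a = Rat.Fract p q" "q > 0" by (cases a) auto
  have "smult (of_int (k * q)) (pCons a u) = map_poly of_int (pCons (k * p) (smult q g))"
  proof -
    have "of_int (k * q) * a = of_int (k * p)" using pq by (simp add: Fract_of_int_quotient)
    moreover have "smult (of_int (k * q)) u = smult (of_int q) (smult (of_int k) u)"
      by (simp add: mult.commute)
    then have "smult (of_int (k * q)) u = map_poly of_int (smult q g)"
      by (simp only: kg(2) of_int_poly_smult)
    moreover have "map_poly (of_int :: int \<Rightarrow> rat) (pCons (k * p) (smult q g)) =
        pCons (of_int (k * p)) (map_poly of_int (smult q g))"
      by (intro poly_eqI) (simp add: coeff_map_poly coeff_pCons split: nat.split)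
    ultimately show ?thesis by (simp only: smult_pCons)
  qed
  moreover have "k * q \<noteq> 0" using kg pq by simp
  ultimately show ?case by blast
qed

text \<open>Gauss's lemma: after clearing denominators the product and \<open>F\<close> agree up to
  integer factors. Primitive parts are multiplicative, so that of the cleared \<open>u\<close>
  divides that of \<open>F\<close> up to sign.\<close>

lemma primitive_factor_of_rat_factor:
  fixes F :: "int poly" and u :: "rat poly"
  assumes u: "u dvd smult a (map_poly of_int F)" and a: "a \<noteq> 0" and F: "F \<noteq> 0"
  shows "\<exists>g s. g dvd F \<and> s \<noteq> 0 \<and> u = smult s (map_poly of_int g)"
proof -
  obtain v where v: "smult a (map_poly of_int F) = u * v" using u by blast
  obtain k g0 where k: "k \<noteq> 0" "smult (of_int k) u = map_poly of_int (g0 :: int poly)"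
    using clear_denominators_rat by blast
  obtain l w0 where l: "l \<noteq> 0" "smult (of_int l) v = map_poly of_int (w0 :: int poly)"
    using clear_denominators_rat by blast
  obtain p q where pq: "a = Rat.Fract p q" "q > 0" by (cases a) auto
  have p: "p \<noteq> 0" using a pq by (auto simp: rat_number_collapse)
  have qa: "of_int q * a = of_int p" using pq by (simp add: Fract_of_int_quotient)
  have "map_poly of_int (smult q (g0 * w0)) = smult (of_int q) (smult (of_int k) u * smult (of_int l) v)"
    by (simp add: k(2) l(2) of_int_poly_smult of_int_poly_hom.hom_mult)
  also have "\<dots> = smult (of_int k * of_int l * of_int q) (u * v)"
    by (simp add: mult_ac)
  also have "\<dots> = smult (of_int k * of_int l * (of_int q * a)) (map_poly of_int F)"
    by (simp add: v[symmetric] mult_ac)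
  also have "\<dots> = smult (of_int (k * l * p)) (map_poly of_int F)"
    by (simp add: qa)
  also have "\<dots> = map_poly of_int (smult (k * l * p) F)"
    by (simp add: of_int_poly_smult)
  finally have eq: "smult q (g0 * w0) = smult (k * l * p) F"
    by (simp only: of_int_poly_hom.eq_iff)
  define g where "g = primitive_part g0"
  have "g dvd primitive_part (smult q (g0 * w0))"
    unfolding primitive_part_smult primitive_part_mult g_def
    by (rule dvd_smult) (rule dvd_triv_left)
  also have "primitive_part (smult q (g0 * w0)) = smult (unit_factor (k * l * p)) (primitive_part F)"
    unfolding eq primitive_part_smult ..
  also have "\<dots> dvd F"
  proof -
    let ?c = "unit_factor (k * l * p)"
    have "is_unit ?c" using k(1) l(1) p by (intro unit_factor_is_unit) simp
    then obtain d where "1 = ?c * d" by (rule dvdE)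
    then have "primitive_part F = smult d (smult ?c (primitive_part F))" by (simp add: mult.commute)
    moreover have "smult ?c (primitive_part F) dvd smult d (smult ?c (primitive_part F))"
      by (rule dvd_smult) (rule dvd_refl)
    ultimately have "smult ?c (primitive_part F) dvd primitive_part F" by simp
    also have "primitive_part F dvd smult (content F) (primitive_part F)"
      by (rule dvd_smult) (rule dvd_refl)
    also have "\<dots> = F" by (rule content_times_primitive_part)
    finally show ?thesis .
  qed
  finally have "g dvd F" .
  moreover have "u = smult (of_int (content g0) / of_int k) (map_poly of_int g)"
  proof -
    have "smult (of_int k) u = map_poly of_int (smult (content g0) g)"
      by (simp add: k(2) g_def)
    then have "smult (of_int k) u = smult (of_int (content g0)) (map_poly of_int g)"
      by (simp add: of_int_poly_smult)
    then have "smult (inverse (of_int k)) (smult (of_int k) u) =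
        smult (inverse (of_int k)) (smult (of_int (content g0)) (map_poly of_int g))" by simp
    then show ?thesis using k(1) by (simp add: field_simps)
  qed
  moreover have "content g0 \<noteq> 0"
  proof
    assume "content g0 = 0"
    then have "smult (k * l * p) F = 0" using eq by simp
    then show False using F k l p by simp
  qed
  ultimately show ?thesis using k(1) by (intro exI[of _ g] exI[of _ "of_int (content g0) / of_int k"]) simp
qed

text \<open>A reducible polynomial of positive degree over Q has two factors of positive degree, and
  \<open>y\<close> is a root of one of them. By Gauss's lemma this factor is proportional to an
  integral divisor of \<open>F\<close>.\<close>

lemma reducible_root_factor:
  fixes F :: "int poly" and y :: complex
  assumes red: "\<not> Factorial_Ring.irreducible (smult a (map_poly of_int F) :: rat poly)"
    and a: "a \<noteq> 0" and F: "degree F > 0" and y: "poly (map_poly of_int F) y = 0"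
  shows "\<exists>g. g dvd F \<and> 0 < degree g \<and> degree g < degree F \<and> poly (map_poly of_int g) y = 0"
proof -
  interpret of_rat_poly: map_poly_inj_idom_hom "of_rat :: rat \<Rightarrow> complex" ..
  define p :: "rat poly" where "p = smult a (map_poly of_int F)"
  have degp: "degree p = degree F" using a by (simp add: p_def)
  then have "p \<noteq> 0" "\<not> is_unit p" using F by (auto simp: is_unit_iff_degree)
  then obtain u v where uv: "p = u * v" "\<not> is_unit u" "\<not> is_unit v"
    using red unfolding p_def[symmetric] irreducible_def by blast
  have nz: "u \<noteq> 0" "v \<noteq> 0" using uv \<open>p \<noteq> 0\<close> by auto
  have deg: "degree u > 0" "degree v > 0" "degree u + degree v = degree F"
    using uv nz degp by (auto simp: is_unit_iff_degree degree_mult_eq)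
  have F0: "F \<noteq> 0" using F by auto
  obtain g s where g: "g dvd F" "s \<noteq> 0" "u = smult s (map_poly of_int g)"
    using primitive_factor_of_rat_factor[of u a F] a F0 uv(1) by (auto simp: p_def)
  obtain w t where w: "w dvd F" "t \<noteq> 0" "v = smult t (map_poly of_int w)"
    using primitive_factor_of_rat_factor[of v a F] a F0 uv(1) by (auto simp: p_def)
  have of_rat_of_int: "map_poly (of_rat :: rat \<Rightarrow> complex) (map_poly of_int q) = map_poly of_int q" for q :: "int poly"
    by (intro poly_eqI) (simp add: coeff_map_poly)
  have "map_poly (of_rat :: rat \<Rightarrow> complex) p = map_poly of_rat u * map_poly of_rat v"
    by (simp add: uv(1) of_rat_poly.hom_mult)
  then have "smult (of_rat a) (map_poly of_int F) =
      smult (of_rat s) (map_poly of_int g) * smult (of_rat t) (map_poly of_int w :: complex poly)"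
    by (simp add: p_def g(3) w(3) map_poly_of_rat_smult of_rat_of_int)
  then have "poly (smult (of_rat a) (map_poly of_int F)) y =
      poly (smult (of_rat s) (map_poly of_int g) * smult (of_rat t) (map_poly of_int w)) y" by simp
  then have "poly (map_poly of_int g) y = 0 \<or> poly (map_poly of_int w) y = 0"
    using y g(2) w(2) by simp
  moreover have "degree g = degree u" "degree w = degree v"
    using g w by simp_all
  moreover have "degree u < degree F" "degree v < degree F" using deg by linarith+
  ultimately show ?thesis using g(1) w(1) deg(1,2) by metis
qed

text \<open>Roots are split off one at a time by the fundamental theorem of algebra, so estimates
  for products over the roots need no enumeration of them.\<close>

lemma complex_poly_root_induct [consumes 1, case_names const factor]:
  fixes p :: "complex poly"
  assumes "p \<noteq> 0"
    and const: "\<And>c. c \<noteq> 0 \<Longrightarrow> P [:c:]"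
    and factor: "\<And>z q. q \<noteq> 0 \<Longrightarrow> P q \<Longrightarrow> P ([:- z, 1:] * q)"
  shows "P p"
  using assms(1)
proof (induction "degree p" arbitrary: p)
  case 0
  then show ?case using const by (metis degree_eq_zeroE pCons_eq_0_iff)
next
  case (Suc n)
  have "\<not> constant (poly p)" using Suc.hyps(2) by (simp add: constant_degree)
  then obtain z where "poly p z = 0" using fundamental_theorem_of_algebra by blast
  then obtain q where q: "p = [:- z, 1:] * q" by (metis poly_eq_0_iff_dvd dvdE)
  then have "q \<noteq> 0" using Suc.prems by auto
  moreover have "degree p = Suc (degree q)"
    unfolding q using \<open>q \<noteq> 0\<close> by (subst degree_mult_eq) auto
  ultimately show ?case using Suc.hyps q factor by simp
qed

text \<open>Multiplication by X - z turns a coefficient into its lower neighbour minus z times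
  itself, so each root raises the bound by the factor 1 + R. A divisor of a polynomial is thereby
  bounded through the roots they share.\<close>

lemma coeff_le_root_bound:
  fixes p :: "complex poly"
  assumes "p \<noteq> 0" "\<And>z. poly p z = 0 \<Longrightarrow> cmod z \<le> R"
  shows "cmod (coeff p i) \<le> cmod (lead_coeff p) * (1 + R) ^ degree p"
  using assms
proof (induction p arbitrary: i rule: complex_poly_root_induct)
  case (const c)
  then show ?case by (cases i) (auto)
next
  case (factor z q)
  have IH: "cmod (coeff q j) \<le> cmod (lead_coeff q) * (1 + R) ^ degree q" for j
    using factor by simp
  have z: "cmod z \<le> R" using factor(3)[of z] by simp
  then have R: "R \<ge> 0" using norm_ge_zero order.trans by blast
  define b where "b = cmod (lead_coeff q) * (1 + R) ^ degree q"
  have b0: "b \<ge> 0" using R by (simp add: b_def)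
  have lc: "lead_coeff ([:- z, 1:] * q) = lead_coeff q"
    by (subst lead_coeff_mult) simp
  have deg: "degree ([:- z, 1:] * q) = Suc (degree q)"
    using factor(1) by (subst degree_mult_eq) auto
  have "coeff ([:- z, 1:] * q) i = (case i of 0 \<Rightarrow> 0 | Suc j \<Rightarrow> coeff q j) - z * coeff q i"
    by (simp add: coeff_pCons)
  also have "cmod \<dots> \<le> b + R * b"
  proof (rule order.trans[OF norm_triangle_ineq4 add_mono])
    show "cmod (case i of 0 \<Rightarrow> 0 | Suc j \<Rightarrow> coeff q j) \<le> b"
      using IH b0 by (auto split: nat.split simp: b_def)
    show "cmod (z * coeff q i) \<le> R * b"
      unfolding norm_mult by (intro mult_mono) (use z R IH in \<open>auto simp: b_def\<close>)
  qed
  also have "b + R * b = cmod (lead_coeff ([:- z, 1:] * q)) * (1 + R) ^ degree ([:- z, 1:] * q)"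
    unfolding lc unfolding deg by (simp add: b_def algebra_simps)
  finally show ?case .
qed

text \<open>|p(w)| is the leading absolute value times the product of the distances from w to the
  roots; these cannot all be at least \<delta>.\<close>

lemma exists_near_root:
  fixes p :: "complex poly"
  assumes "p \<noteq> 0" "\<delta> \<ge> 0" "cmod (poly p w) < cmod (lead_coeff p) * \<delta> ^ degree p"
  shows "\<exists>z. poly p z = 0 \<and> cmod (w - z) < \<delta>"
proof (rule ccontr)
  assume "\<not> ?thesis"
  then have far: "\<And>z. poly p z = 0 \<Longrightarrow> \<delta> \<le> cmod (w - z)" by force
  have "cmod (lead_coeff p) * \<delta> ^ degree p \<le> cmod (poly p w)"
    using assms(1) far
  proof (induction p rule: complex_poly_root_induct)
    case (const c)
    then show ?case by simp
  next
    case (factor z q)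
    have lc: "lead_coeff ([:- z, 1:] * q) = lead_coeff q"
      by (subst lead_coeff_mult) simp
    have deg: "degree ([:- z, 1:] * q) = Suc (degree q)"
      using factor(1) by (subst degree_mult_eq) auto
    have "\<delta> * (cmod (lead_coeff q) * \<delta> ^ degree q) \<le> cmod (w - z) * cmod (poly q w)"
      using factor assms(2) by (intro mult_mono) auto
    also have "\<dots> = cmod (poly ([:- z, 1:] * q) w)"
      unfolding poly_mult by (simp add: norm_mult)
    finally show ?case unfolding lc unfolding deg by (simp add: algebra_simps)
  qed
  then show False using assms(3) by simp
qed

text \<open>A bound of Cauchy's type: outside the unit disc the leading term is balanced by n terms
  of size at most h |z|^(n - 1).\<close>

lemma root_le_coeff_bound:
  fixes p :: "complex poly"
  assumes "poly p z = 0" "cmod (lead_coeff p) \<ge> 1" "\<And>i. cmod (coeff p i) \<le> h"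
  shows "cmod z \<le> 1 + real (degree p) * h"
proof (cases "cmod z \<le> 1")
  case True
  have "h \<ge> 0" using assms(3) norm_ge_zero order.trans by blast
  then show ?thesis using True by (smt (verit) mult_nonneg_nonneg of_nat_0_le_iff)
next
  case False
  define n where "n = degree p"
  have "n \<noteq> 0"
  proof
    assume "n = 0"
    then obtain c where "p = [:c:]" using n_def degree_eq_zeroE by metis
    then show False using assms(1,2) by simp
  qed
  have sum: "(\<Sum>i<n. coeff p i * z ^ i) + coeff p n * z ^ n = 0"
    using assms(1) by (simp add: poly_altdef n_def lessThan_Suc_atMost[symmetric])
  then have "coeff p n * z ^ n = - (\<Sum>i<n. coeff p i * z ^ i)" by (simp add: eq_neg_iff_add_eq_0 add.commute)
  then have "cmod (coeff p n) * cmod z ^ n = cmod (\<Sum>i<n. coeff p i * z ^ i)"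
    by (metis norm_minus_cancel norm_mult norm_power)
  moreover have "cmod z ^ n \<le> cmod (coeff p n) * cmod z ^ n"
    using assms(2) by (simp add: n_def mult_le_cancel_right1)
  ultimately have "cmod z ^ n \<le> cmod (\<Sum>i<n. coeff p i * z ^ i)" by simp
  also have "\<dots> \<le> (\<Sum>i<n. h * cmod z ^ (n - 1))"
  proof (rule sum_norm_le)
    fix i assume "i \<in> {..<n}"
    then show "cmod (coeff p i * z ^ i) \<le> h * cmod z ^ (n - 1)"
      unfolding norm_mult norm_power using False assms(3) norm_ge_zero order.trans
      by (intro mult_mono power_increasing) (auto intro: order.trans[OF norm_ge_zero assms(3)])
  qed
  also have "\<dots> = n * h * cmod z ^ (n - 1)" by simp
  finally have "cmod z * cmod z ^ (n - 1) \<le> n * h * cmod z ^ (n - 1)"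
    using \<open>n \<noteq> 0\<close> by (cases n) auto
  then have "cmod z \<le> n * h" using False by (simp add: mult_le_cancel_right) (smt (verit) power_less_zero_eq zero_less_power)
  then show ?thesis by (simp add: n_def)
qed

subsection \<open>The auxiliary polynomial\<close>

text \<open>Killing the coefficients at d, ..., d + k - 1 puts k linear conditions on more than k
  unknowns. The induction is Gaussian elimination: a pivot clears the top position unless it is
  already clear.\<close>

lemma linear_combination_low_degree:
  fixes p :: "'i \<Rightarrow> 'a::field poly"
  assumes "finite I" "card I > k" "\<And>i j. i \<in> I \<Longrightarrow> j \<ge> d + k \<Longrightarrow> coeff (p i) j = 0"
  shows "\<exists>q. (\<exists>i\<in>I. q i \<noteq> 0) \<and> (\<forall>j\<ge>d. coeff (\<Sum>i\<in>I. smult (q i) (p i)) j = 0)"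
  using assms
proof (induction k arbitrary: I p)
  case 0
  then have "I \<noteq> {}" by auto
  then show ?case using 0 by (intro exI[of _ "\<lambda>_. 1"]) (auto simp: coeff_sum)
next
  case (Suc k)
  define t where "t = (\<lambda>i. coeff (p i) (d + k))"
  show ?case
  proof (cases "\<forall>i\<in>I. t i = 0")
    case True
    have "coeff (p i) j = 0" if "i \<in> I" "j \<ge> d + k" for i j
      using True Suc.prems(3)[OF that(1), of j] that by (cases "j = d + k") (auto simp: t_def)
    then show ?thesis using Suc.IH[of I p] Suc.prems by simp
  next
    case False
    then obtain l where l: "l \<in> I" "t l \<noteq> 0" by blast
    define p' where "p' = (\<lambda>i. p i - smult (t i / t l) (p l))"
    have "coeff (p' i) j = 0" if "i \<in> I - {l}" "j \<ge> d + k" for i j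
      using Suc.prems(3)[of i j] Suc.prems(3)[OF l(1), of j] that l(2)
      by (cases "j = d + k") (auto simp: p'_def t_def)
    moreover have "card (I - {l}) > k" using Suc.prems(1,2) l(1) by simp
    ultimately obtain q where q: "\<exists>i\<in>I - {l}. q i \<noteq> 0"
      "\<forall>j\<ge>d. coeff (\<Sum>i\<in>I - {l}. smult (q i) (p' i)) j = 0"
      using Suc.IH[of "I - {l}" p'] Suc.prems(1) by blast
    \<comment> \<open>The pivot receives the total of its multiples subtracted in \<open>p'\<close>,
      so both combinations agree.\<close>
    define q' where "q' = q(l := - (\<Sum>i\<in>I - {l}. q i * (t i / t l)))"
    have "(\<Sum>i\<in>I. smult (q' i) (p i)) = smult (q' l) (p l) + (\<Sum>i\<in>I - {l}. smult (q i) (p i))"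
      using Suc.prems(1) l(1) by (subst sum.remove[of _ l]) (auto simp: q'_def intro!: sum.cong)
    also have "\<dots> = (\<Sum>i\<in>I - {l}. smult (q i) (p' i))"
      by (simp add: q'_def p'_def smult_diff_right sum_subtractf smult_sum)
    finally have "(\<Sum>i\<in>I. smult (q' i) (p i)) = (\<Sum>i\<in>I - {l}. smult (q i) (p' i))" .
    moreover have "\<exists>i\<in>I. q' i \<noteq> 0" using q(1) by (auto simp: q'_def)
    ultimately show ?thesis using q(2) by (intro exI[of _ q']) simp
  qed
qed

lemma common_denominator:
  fixes q :: "'i \<Rightarrow> rat"
  assumes "finite I"
  shows "\<exists>K q'. K \<noteq> 0 \<and> (\<forall>i\<in>I. of_int (q' i) = of_int (K :: int) * q i)"
  using assms
proof (induction I)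
  case empty
  show ?case by (intro exI[of _ 1]) simp
next
  case (insert a I)
  obtain K q' where K: "K \<noteq> 0" "\<And>i. i \<in> I \<Longrightarrow> of_int (q' i) = of_int (K :: int) * q i"
    using insert.IH by blast
  obtain u v where uv: "q a = Rat.Fract u v" "v > 0" by (cases "q a") auto
  have "of_int (((\<lambda>i. v * q' i)(a := K * u)) i) = of_int (K * v) * q i" if "i \<in> insert a I" for i
    using K(2)[of i] that uv insert.hyps by (auto simp: Fract_of_int_quotient)
  then show ?case using K(1) uv(2)
    by (intro exI[of _ "K * v"] exI[of _ "(\<lambda>i. v * q' i)(a := K * u)"]) simp
qed

text \<open>A dimension count. The unknowns are the n (D + 1) coefficients of P. The sum is t^(M (n
  - 1)) P(t, t^k G/t^M), of degree at most D + k (n - 1) + M (n - 1); lowering this to M (n - 1) - N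
  kills D + k (n - 1) + N coefficients, fewer than the unknowns.\<close>

lemma auxiliary_polynomial:
  fixes G :: "rat poly"
  assumes G: "degree G \<le> M" and N: "N \<le> M * (n - 1)"
    and count: "D + k * (n - 1) + N < n * (D + 1)"
  shows "\<exists>P :: int poly poly. P \<noteq> 0 \<and> degree P < n \<and> (\<forall>i. degree (coeff P i) \<le> D) \<and>
    degree (\<Sum>i<n. map_poly of_int (coeff P i) * monom 1 (k * i + M * (n - 1 - i)) * G ^ i) + N \<le> M * (n - 1)"
proof -
  define I where "I = {..<n} \<times> {..D}"
  define p :: "nat \<times> nat \<Rightarrow> rat poly" where
    "p = (\<lambda>(i, j). monom 1 j * (monom 1 (k * i + M * (n - 1 - i)) * G ^ i))"
  \<comment> \<open>\<open>d\<close> is the first position that must vanish, and \<open>l\<close>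
    counts the positions from there up to the a priori degree.\<close>
  define d where "d = M * (n - 1) - N + 1"
  define l where "l = D + k * (n - 1) + N"
  have I: "finite I" "card I > l" using count by (simp_all add: I_def l_def)
  have "coeff (p z) s = 0" if "z \<in> I" "s \<ge> d + l" for z s
  proof -
    obtain i j where z: "z = (i, j)" "i < n" "j \<le> D" using \<open>z \<in> I\<close> by (auto simp: I_def)
    have "degree (p z) \<le> j + ((k * i + M * (n - 1 - i)) + degree (G ^ i))"
      unfolding z p_def prod.case
      by (intro order.trans[OF degree_mult_le] add_mono) (auto simp: degree_monom_eq)
    also have "degree (G ^ i) \<le> M * i"
      using degree_power_le[of G i] G by (meson mult_le_mono1 order.trans)
    also have "j + (k * i + M * (n - 1 - i) + M * i) = j + k * i + M * (n - 1)"
    proof -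
      have "M * (n - 1 - i) + M * i = M * (n - 1)" using z(2) by (simp flip: distrib_left)
      then show ?thesis by simp
    qed
    also have "\<dots> \<le> D + k * (n - 1) + M * (n - 1)" using z by (intro add_mono mult_mono) auto
    also have "\<dots> < d + l" using N by (simp add: d_def l_def)
    finally show ?thesis using that(2) by (intro coeff_eq_0) simp
  qed
  then obtain q where q: "\<exists>z\<in>I. q z \<noteq> 0" "\<forall>j\<ge>d. coeff (\<Sum>z\<in>I. smult (q z) (p z)) j = 0"
    using linear_combination_low_degree[OF I] by blast
  obtain K q' where K: "K \<noteq> 0" "\<And>z. z \<in> I \<Longrightarrow> of_int (q' z) = of_int (K :: int) * q z"
    using common_denominator[OF I(1)] by metis
  define P where "P = (\<Sum>i<n. monom (\<Sum>j\<le>D. monom (q' (i, j)) j) i)"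
  have coeff_P: "coeff P i = (if i < n then \<Sum>j\<le>D. monom (q' (i, j)) j else 0)" for i
    by (simp add: P_def coeff_sum)
  have coeff_P2: "coeff (coeff P i) j = (if i < n \<and> j \<le> D then q' (i, j) else 0)" for i j
    by (simp add: coeff_P coeff_sum)
  obtain i j where "(i, j) \<in> I" "q (i, j) \<noteq> 0" using q(1) by auto
  then have "q' (i, j) \<noteq> 0" using K by (metis mult_eq_0_iff of_int_0 of_int_eq_0_iff)
  then have "coeff (coeff P i) j \<noteq> 0" using \<open>(i, j) \<in> I\<close> by (simp add: coeff_P2 I_def)
  then have "P \<noteq> 0" by auto
  moreover have "degree P < n"
  proof (rule ccontr)
    assume "\<not> degree P < n"
    then have "lead_coeff P = 0" by (simp add: coeff_P)
    then show False using \<open>P \<noteq> 0\<close> by simp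
  qed
  moreover have "degree (coeff P i) \<le> D" for i
    by (rule degree_le) (simp add: coeff_P2)
  moreover have "degree (\<Sum>i<n. map_poly of_int (coeff P i) * monom 1 (k * i + M * (n - 1 - i)) * G ^ i) + N \<le> M * (n - 1)"
  proof -
    have "map_poly of_int (coeff P i) = (\<Sum>j\<le>D. smult (of_int K * q (i, j)) (monom 1 j))" if "i < n" for i
    proof (rule poly_eqI)
      fix s
      show "coeff (map_poly of_int (coeff P i)) s = coeff (\<Sum>j\<le>D. smult (of_int K * q (i, j)) (monom 1 j)) s"
        using K(2)[of "(i, s)"] that by (simp add: coeff_map_poly coeff_P2 coeff_sum I_def if_distrib cong: if_cong)
    qed
    then have "(\<Sum>i<n. map_poly of_int (coeff P i) * monom 1 (k * i + M * (n - 1 - i)) * G ^ i) =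
      (\<Sum>i<n. \<Sum>j\<le>D. smult (of_int K * q (i, j)) (p (i, j)))"
      by (intro sum.cong) (simp_all add: p_def sum_distrib_right mult.assoc)
    also have "\<dots> = smult (of_int K) (\<Sum>z\<in>I. smult (q z) (p z))"
      by (simp add: I_def sum.cartesian_product smult_sum2 case_prod_unfold)
    finally have eq: "(\<Sum>i<n. map_poly of_int (coeff P i) * monom 1 (k * i + M * (n - 1 - i)) * G ^ i) =
      smult (of_int K) (\<Sum>z\<in>I. smult (q z) (p z))" .
    have "degree (smult (of_int K) (\<Sum>z\<in>I. smult (q z) (p z))) \<le> M * (n - 1) - N"
      using q(2) by (intro degree_le) (simp add: d_def)
    then show ?thesis unfolding eq using N by simp
  qed
  ultimately show ?thesis by blast
qed

text \<open>A nonzero element of least degree in the ideal of f and p divides both, by division with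
  remainder. Dividing the irreducible f, it is a unit, or else f divides p against the
  degrees.\<close>

lemma bezout_irreducible:
  fixes f p :: "'a::field poly"
  assumes f: "Factorial_Ring.irreducible f" and p: "p \<noteq> 0" "degree p < degree f"
  shows "\<exists>a b. a * f + b * p = 1"
proof -
  define S where "S = {s. s \<noteq> 0 \<and> (\<exists>a b. s = a * f + b * p)}"
  have "p = 0 * f + 1 * p" by simp
  then have "p \<in> S" using p(1) unfolding S_def by blast
  then obtain s where s: "s \<in> S" "\<And>s'. s' \<in> S \<Longrightarrow> degree s \<le> degree s'"
    using ex_has_least_nat[of "\<lambda>s. s \<in> S" p degree] by blast
  obtain a b where ab: "s = a * f + b * p" "s \<noteq> 0" using s(1) by (auto simp: S_def)
  have dvd: "s dvd h" if h: "h = u * f + v * p" for h u v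
  proof (rule ccontr)
    assume "\<not> s dvd h"
    then have nz: "h mod s \<noteq> 0" by (simp add: mod_eq_0_iff_dvd)
    have "h mod s = h - h div s * s" by (rule minus_div_mult_eq_mod[symmetric])
    also have "\<dots> = (u - h div s * a) * f + (v - h div s * b) * p"
      unfolding ab(1) h by (simp add: algebra_simps)
    finally have "h mod s \<in> S" using nz unfolding S_def by blast
    then show False using s(2) degree_mod_less'[OF ab(2) nz] by fastforce
  qed
  have "s dvd f" "s dvd p" using dvd[of f 1 0] dvd[of p 0 1] by simp_all
  then consider "f dvd s" | "is_unit s" using irreducibleD'[OF f] by blast
  then show ?thesis
  proof cases
    case 1
    then have "f dvd p" using \<open>s dvd p\<close> by (rule dvd_trans)
    then show ?thesis using dvd_imp_degree_le[of f p] p by simp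
  next
    case 2
    then obtain t where "1 = s * t" by (rule dvdE)
    then have "(t * a) * f + (t * b) * p = 1" unfolding ab(1) by (simp add: algebra_simps)
    then show ?thesis by blast
  qed
qed

section \<open>Integral models over Z[t] and coprimality\<close>

definition ratfun_of_int_poly :: "int poly \<Rightarrow> ratfun" where
  "ratfun_of_int_poly q = to_fract (map_poly of_int q)"

interpretation ratfun_of_int_poly: inj_idom_hom ratfun_of_int_poly
  by unfold_locales (auto simp: ratfun_of_int_poly_def of_int_poly_hom.hom_mult of_int_poly_hom.hom_add)

interpretation ratfun_of_int_poly_poly: map_poly_inj_idom_hom ratfun_of_int_poly ..

lemma map_poly_ratfun_of_int_poly_smult:
  "map_poly ratfun_of_int_poly (smult c p) = smult (ratfun_of_int_poly c) (map_poly ratfun_of_int_poly p)"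
  by (intro poly_eqI) (simp add: coeff_map_poly ratfun_of_int_poly.hom_mult)

lemma map_poly_ratfun_of_int_poly_pCons:
  "map_poly ratfun_of_int_poly (pCons c p) = pCons (ratfun_of_int_poly c) (map_poly ratfun_of_int_poly p)"
  by (intro poly_eqI) (simp add: coeff_map_poly coeff_pCons split: nat.split)

lemma clear_denominators_ratfun:
  fixes u :: "ratfun poly"
  shows "\<exists>q g. q \<noteq> 0 \<and> smult (ratfun_of_int_poly q) u = map_poly ratfun_of_int_poly g"
proof (induction u)
  case 0
  show ?case by (intro exI[of _ 1] exI[of _ 0]) simp
next
  case (pCons a u)
  obtain q g where qg: "q \<noteq> 0" "smult (ratfun_of_int_poly q) u = map_poly ratfun_of_int_poly g"
    using pCons by blast
  obtain r s where rs: "a = Fraction_Field.Fract r s" "s \<noteq> 0" using Fract_cases by blast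
  obtain k r' where k: "k \<noteq> 0" "smult (of_int k) r = map_poly of_int (r' :: int poly)"
    using clear_denominators_rat by blast
  obtain l s' where l: "l \<noteq> 0" "smult (of_int l) s = map_poly of_int (s' :: int poly)"
    using clear_denominators_rat by blast
  have "map_poly of_int s' \<noteq> (0 :: rat poly)" using l rs(2) by (metis of_int_eq_0_iff smult_eq_0_iff)
  then have s': "s' \<noteq> 0" by auto
  \<comment> \<open>Since a = r/s with k r = r' and l s = s', both sides are k l r.\<close>
  have a_eq: "ratfun_of_int_poly (smult k s') * a = ratfun_of_int_poly (smult l r')"
  proof -
    have "map_poly of_int (smult k s') * r = map_poly of_int (smult l r') * s"
      by (simp add: of_int_poly_smult flip: k(2) l(2)) (simp add: mult.commute)
    then show ?thesis using rs(2)
      by (simp add: ratfun_of_int_poly_def rs(1) to_fract_def eq_fract)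
  qed
  have "ratfun_of_int_poly (smult k s' * q) * a = ratfun_of_int_poly (smult k s') * a * ratfun_of_int_poly q"
    by (simp only: ratfun_of_int_poly.hom_mult mult_ac)
  then have "ratfun_of_int_poly (smult k s' * q) * a = ratfun_of_int_poly (smult l r' * q)"
    by (simp only: a_eq ratfun_of_int_poly.hom_mult)
  moreover have "smult (ratfun_of_int_poly (smult k s' * q)) u =
      map_poly ratfun_of_int_poly (smult (smult k s') g)"
    by (simp only: map_poly_ratfun_of_int_poly_smult qg(2)[symmetric] ratfun_of_int_poly.hom_mult smult_smult)
  ultimately have "smult (ratfun_of_int_poly (smult k s' * q)) (pCons a u) =
      map_poly ratfun_of_int_poly (pCons (smult l r' * q) (smult (smult k s') g))"
    by (simp only: map_poly_ratfun_of_int_poly_pCons smult_pCons)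
  moreover have "smult k s' * q \<noteq> 0" using k(1) s' qg(1) by simp
  ultimately show ?case by blast
qed

text \<open>Irreducibility over Q(t) makes f and P coprime, and clearing denominators leaves a
  nonzero r in Z[t]. At every integer c with r(c) nonzero, the identity survives specialization with
  a nonzero right-hand side.\<close>

lemma bezout_int_poly_poly:
  fixes F P :: "int poly poly"
  assumes f: "Factorial_Ring.irreducible f" and F: "smult (ratfun_of_int_poly q) f = map_poly ratfun_of_int_poly F"
    and q: "q \<noteq> 0" and P: "P \<noteq> 0" "degree P < degree F"
  shows "\<exists>A B r. r \<noteq> 0 \<and> A * F + B * P = [:r:]"
proof -
  define \<iota> where "\<iota> = ratfun_of_int_poly"
  have \<iota>0: "\<iota> c = 0 \<longleftrightarrow> c = 0" for c by (simp add: \<iota>_def)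
  have "degree f = degree (smult (\<iota> q) f)" using q \<iota>0 by simp
  also have "\<dots> = degree F" unfolding \<iota>_def F by simp
  finally have "degree (map_poly \<iota> P) < degree f" using P(2) by (simp add: \<iota>_def)
  moreover have "map_poly \<iota> P \<noteq> 0" using P(1) by (simp add: \<iota>_def)
  ultimately obtain a b where ab: "a * f + b * map_poly \<iota> P = 1"
    using bezout_irreducible[OF f] by blast
  obtain s A where s: "s \<noteq> 0" "smult (\<iota> s) a = map_poly \<iota> A"
    using clear_denominators_ratfun unfolding \<iota>_def by blast
  obtain t B where t: "t \<noteq> 0" "smult (\<iota> t) b = map_poly \<iota> B"
    using clear_denominators_ratfun unfolding \<iota>_def by blast
  have "map_poly \<iota> (smult t A * F + smult (q * s) B * P) =
    smult (\<iota> t) (smult (\<iota> s) a) * smult (\<iota> q) f + smult (\<iota> (q * s)) (smult (\<iota> t) b) * map_poly \<iota> P"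
    unfolding s(2) t(2) F[folded \<iota>_def]
    by (simp add: \<iota>_def ratfun_of_int_poly_poly.hom_add ratfun_of_int_poly_poly.hom_mult map_poly_ratfun_of_int_poly_smult)
  also have "\<dots> = smult (\<iota> (q * s * t)) (a * f + b * map_poly \<iota> P)"
    by (simp add: \<iota>_def ratfun_of_int_poly.hom_mult smult_add_right mult_ac)
  also have "\<dots> = map_poly \<iota> [:q * s * t:]" unfolding ab unfolding \<iota>_def map_poly_ratfun_of_int_poly_pCons by simp
  finally have "smult t A * F + smult (q * s) B * P = [:q * s * t:]"
    by (simp only: \<iota>_def ratfun_of_int_poly_poly.eq_iff)
  then show ?thesis using q s(1) t(1) by (metis mult_eq_0_iff)
qed

subsection \<open>Approximate roots at a fixed integer\<close>

lemma norm_power_diff_le: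
  fixes a b :: "'a::{real_normed_algebra_1, comm_ring_1}"
  assumes "norm a \<le> R" "norm b \<le> R" "R \<ge> 1"
  shows "norm (a ^ i - b ^ i) \<le> real i * R ^ i * norm (a - b)"
proof (induction i)
  case 0
  then show ?case by simp
next
  case (Suc i)
  have "a ^ Suc i - b ^ Suc i = a * (a ^ i - b ^ i) + (a - b) * b ^ i" by (simp add: algebra_simps)
  also have "norm \<dots> \<le> norm a * norm (a ^ i - b ^ i) + norm (a - b) * norm (b ^ i)"
    by (intro order.trans[OF norm_triangle_ineq] add_mono norm_mult_ineq)
  also have "\<dots> \<le> R * (real i * R ^ i * norm (a - b)) + norm (a - b) * R ^ Suc i"
  proof (intro add_mono mult_mono Suc.IH assms)
    have "norm (b ^ i) \<le> norm b ^ i" by (rule norm_power_ineq)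
    also have "\<dots> \<le> R ^ i" using assms by (intro power_mono) auto
    also have "\<dots> \<le> R ^ Suc i" using assms(3) by (intro power_increasing) auto
    finally show "norm (b ^ i) \<le> R ^ Suc i" .
  qed (use assms in auto)
  also have "\<dots> = real (Suc i) * R ^ Suc i * norm (a - b)" by (simp add: algebra_simps)
  finally show ?case .
qed

text \<open>All sizes are measured in powers of \<open>T\<close>, which is large enough to absorb
  the constants. The roots of g are roots of F, and its leading coefficient divides that of F;
  together they bound every coefficient of g uniformly over the divisors.\<close>

lemma factor_size_bound:
  fixes F g :: "int poly"
  assumes F: "degree F = n" "F \<noteq> 0" and g: "g dvd F"
    and T: "T \<ge> 2" "T \<ge> real n + 1"
    and le: "\<And>i. \<bar>real_of_int (coeff F i)\<bar> \<le> T ^ k"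
  shows "poly (map_poly of_int g) (y :: complex) = 0 \<Longrightarrow> cmod y \<le> T ^ (k + 1)"
    and "\<bar>real_of_int (coeff g i)\<bar> \<le> T ^ (k + n * (k + 2))"
proof -
  have "1 \<le> T" using T by simp
  obtain h where h: "F = g * h" using g by blast
  then have nz: "g \<noteq> 0" "h \<noteq> 0" using F(2) by auto
  show root: "cmod y \<le> T ^ (k + 1)" if "poly (map_poly of_int g) y = 0" for y :: complex
  proof -
    have "poly (map_poly of_int F) y = 0"
      using that by (simp add: h of_int_poly_hom.hom_mult)
    moreover have "1 \<le> cmod (lead_coeff (map_poly of_int F :: complex poly))"
    proof -
      have "lead_coeff F \<noteq> 0" using F(2) by simp
      then have "1 \<le> \<bar>real_of_int (lead_coeff F)\<bar>" by linarith
      then show ?thesis by (simp add: coeff_map_poly)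
    qed
    ultimately have "cmod y \<le> 1 + real (degree (map_poly of_int F :: complex poly)) * T ^ k"
      using le by (intro root_le_coeff_bound) (auto simp: coeff_map_poly)
    also have "\<dots> \<le> T ^ k + real n * T ^ k" using \<open>1 \<le> T\<close> F(1) by simp
    also have "\<dots> = (real n + 1) * T ^ k" by (simp add: algebra_simps)
    also have "\<dots> \<le> T * T ^ k" using T(2) \<open>1 \<le> T\<close> by (intro mult_right_mono) auto
    finally show ?thesis by simp
  qed
  have "cmod (coeff (map_poly of_int g) i) \<le>
      cmod (lead_coeff (map_poly of_int g :: complex poly)) * (1 + T ^ (k + 1)) ^ degree (map_poly of_int g :: complex poly)"
    using nz(1) root by (intro coeff_le_root_bound) auto
  then have "\<bar>real_of_int (coeff g i)\<bar> \<le> \<bar>real_of_int (lead_coeff g)\<bar> * (1 + T ^ (k + 1)) ^ degree g"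
    by (simp add: coeff_map_poly)
  also have "\<dots> \<le> T ^ k * (T ^ (k + 2)) ^ n"
  proof (rule mult_mono)
    have "lead_coeff g dvd lead_coeff F" unfolding h lead_coeff_mult by simp
    then have "\<bar>lead_coeff g\<bar> \<le> \<bar>lead_coeff F\<bar>" using F(2) by (intro dvd_imp_le_int) auto
    then show "\<bar>real_of_int (lead_coeff g)\<bar> \<le> T ^ k" using le[of "degree F"] by linarith
    have "1 + T ^ (k + 1) \<le> T ^ (k + 1) + T ^ (k + 1)" using one_le_power[OF \<open>1 \<le> T\<close>, of "k + 1"] by linarith
    also have "\<dots> = 2 * T ^ (k + 1)" by simp
    also have "\<dots> \<le> T * T ^ (k + 1)" using T(1) by (intro mult_right_mono) auto
    finally have "(1 + T ^ (k + 1)) ^ degree g \<le> (T ^ (k + 2)) ^ degree g"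
      using \<open>1 \<le> T\<close> by (intro power_mono) (auto simp: add_nonneg_nonneg)
    also have "\<dots> \<le> (T ^ (k + 2)) ^ n"
      using \<open>1 \<le> T\<close> F(1) dvd_imp_degree_le[OF g F(2)] by (intro power_increasing one_le_power) auto
    finally show "(1 + T ^ (k + 1)) ^ degree g \<le> (T ^ (k + 2)) ^ n" .
  qed (use \<open>1 \<le> T\<close> in \<open>auto simp: add_nonneg_nonneg\<close>)
  also have "\<dots> = T ^ (k + n * (k + 2))" unfolding power_add mult.commute[of n] power_mult by simp
  finally show "\<bar>real_of_int (coeff g i)\<bar> \<le> T ^ (k + n * (k + 2))" .
qed

text \<open>A Lipschitz estimate that carries the smallness of P from the approximate root w to a
  true root y.\<close>

lemma poly_value_near:
  fixes P :: "int poly" and y w :: complex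
  assumes deg: "degree P < n" and P: "\<And>i. \<bar>real_of_int (coeff P i)\<bar> \<le> H"
    and R: "cmod y \<le> R" "cmod w \<le> R" "R \<ge> 1"
  shows "cmod (poly (map_poly of_int P) y) \<le>
    cmod (poly (map_poly of_int P) w) + real n * (H * (real n * R ^ n * cmod (y - w)))"
proof -
  have H: "H \<ge> 0" using P[of 0] by linarith
  have eval: "poly (map_poly of_int P) v = (\<Sum>i<n. complex_of_int (coeff P i) * v ^ i)" for v
  proof -
    have "poly (map_poly of_int P) v = (\<Sum>i\<le>degree P. complex_of_int (coeff P i) * v ^ i)"
      by (simp add: poly_altdef coeff_map_poly)
    also have "\<dots> = (\<Sum>i<n. complex_of_int (coeff P i) * v ^ i)"
      using deg by (intro sum.mono_neutral_left) (auto simp: coeff_eq_0)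
    finally show ?thesis .
  qed
  have "cmod (poly (map_poly of_int P) y - poly (map_poly of_int P) w) =
      cmod (\<Sum>i<n. complex_of_int (coeff P i) * (y ^ i - w ^ i))"
    by (simp add: eval right_diff_distrib sum_subtractf)
  also have "\<dots> \<le> (\<Sum>i<n. H * (real n * R ^ n * cmod (y - w)))"
  proof (rule sum_norm_le)
    fix i assume i: "i \<in> {..<n}"
    have "cmod (y ^ i - w ^ i) \<le> real i * R ^ i * cmod (y - w)"
      by (rule norm_power_diff_le[OF R])
    also have "\<dots> \<le> real n * R ^ n * cmod (y - w)"
      using i R(3) by (intro mult_right_mono mult_mono power_increasing) auto
    finally show "cmod (complex_of_int (coeff P i) * (y ^ i - w ^ i)) \<le> H * (real n * R ^ n * cmod (y - w))"
      unfolding norm_mult using P H by (intro mult_mono) auto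
  qed
  also have "\<dots> = real n * (H * (real n * R ^ n * cmod (y - w)))" by simp
  finally show ?thesis using norm_triangle_sub[of "poly (map_poly of_int P) y" "poly (map_poly of_int P) w"] by linarith
qed

text \<open>The core estimate, with \<open>T\<close> in the role of |c|. A root y of F next to w has
  |P(y)| at most T^(1 - N). If F were reducible, the resultant of P with a factor vanishing at y
  would bound |P(y)| from below, in conflict with the size of \<open>N\<close>.\<close>

lemma no_proper_factor_near_approximate_root:
  fixes F P A B :: "int poly" and w :: complex and T :: real
  assumes n: "degree F = n" "n > 0"
    and T: "T \<ge> 2" "T \<ge> real n + 1" "T \<ge> fact (2 * n)"
    and F_le: "\<And>i. \<bar>real_of_int (coeff F i)\<bar> \<le> T ^ k"
    and P: "degree P < n" and P_le: "\<And>i. \<bar>real_of_int (coeff P i)\<bar> \<le> T ^ D"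
    and Fw: "cmod (poly (map_poly of_int F) w) * T ^ (n * (D + 2 + (k + 2) * n + N)) < 1"
    and Pw: "cmod (poly (map_poly of_int P) w) * T ^ N \<le> 1"
    and N: "N \<ge> 3 + (k + n * (k + 2)) * n + D * (n - 2) + (k + 1) * n"
    and bez: "A * F + B * P = [:r:]" "r \<noteq> 0"
    and a: "a \<noteq> 0"
  shows "Factorial_Ring.irreducible (smult a (map_poly of_int F) :: rat poly)"
proof (rule ccontr)
  assume red: "\<not> Factorial_Ring.irreducible (smult a (map_poly of_int F) :: rat poly)"
  \<comment> \<open>The exponents pay for the Lipschitz estimate: \<open>D\<close> for the
    coefficients of P, 2 for two factors n, (k + 2) n for the size of y and w, and \<open>N\<close>
    for the target.\<close>
  define L where "L = D + 2 + (k + 2) * n + N"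
  have T1: "T \<ge> 1" "T > 0" using T(1) by auto
  have F0: "F \<noteq> 0" using n by auto
  \<comment> \<open>By \<open>Fw\<close>, |F(w)| is below the n-th power of T^-L, and an integral
    leading coefficient is at least 1 in absolute value.\<close>
  have "\<exists>y. poly (map_poly of_int F) y = 0 \<and> cmod (w - y) < 1 / T ^ L"
  proof (rule exists_near_root)
    show "map_poly of_int F \<noteq> (0 :: complex poly)" using F0 by simp
    show "0 \<le> 1 / T ^ L" using T1 by simp
    have "lead_coeff F \<noteq> 0" using F0 by simp
    then have "1 \<le> \<bar>real_of_int (lead_coeff F)\<bar>" by linarith
    then have lc: "1 \<le> cmod (lead_coeff (map_poly of_int F :: complex poly))" by (simp add: coeff_map_poly)
    have "cmod (poly (map_poly of_int F) w) < 1 / T ^ (n * L)"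
      using Fw T1 by (simp add: L_def field_simps)
    also have "\<dots> = (1 / T ^ L) ^ n" by (simp add: power_divide mult.commute flip: power_mult)
    also have "\<dots> \<le> cmod (lead_coeff (map_poly of_int F :: complex poly)) * (1 / T ^ L) ^ degree (map_poly of_int F :: complex poly)"
      using lc T1 n(1) by (simp add: mult_le_cancel_right1 divide_right_mono)
    finally show "cmod (poly (map_poly of_int F) w) < \<dots>" .
  qed
  then obtain y where y: "poly (map_poly of_int F) y = 0" "cmod (w - y) < 1 / T ^ L" by blast
  obtain g where g: "g dvd F" "0 < degree g" "degree g < n" "poly (map_poly of_int g) y = 0"
    using reducible_root_factor[OF red a _ y(1)] n by auto
  define m where "m = degree g"
  obtain h where h: "F = g * h" using g(1) by blast
  have y_le: "cmod y \<le> T ^ (k + 1)"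
    by (rule factor_size_bound(1)[OF n(1) F0 g(1) T(1,2) F_le g(4)])
  have g_le: "\<bar>real_of_int (coeff g i)\<bar> \<le> T ^ (k + n * (k + 2))" for i
    by (rule factor_size_bound(2)[OF n(1) F0 g(1) T(1,2) F_le])
  have y_le': "cmod y \<le> T ^ (k + 2)"
    by (rule order.trans[OF y_le power_increasing]) (use T1 in auto)
  have w_le: "cmod w \<le> T ^ (k + 2)"
  proof -
    have "cmod w \<le> cmod y + cmod (w - y)" by (metis add.commute diff_add_cancel norm_triangle_ineq)
    also have "cmod (w - y) \<le> 1" using y(2) T1 by (meson divide_le_eq_1_pos less_imp_le one_le_power order.trans zero_less_power)
    also have "cmod y + 1 \<le> T ^ (k + 1) + T ^ (k + 1)" using y_le one_le_power[OF T1(1), of "k + 1"] by linarith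
    also have "\<dots> = 2 * T ^ (k + 1)" by simp
    also have "\<dots> \<le> T * T ^ (k + 1)" using T(1) by (intro mult_right_mono) auto
    finally show ?thesis by simp
  qed
  define Py where "Py = cmod (poly (map_poly of_int P) y)"
  \<comment> \<open>The value at w and the passage from w to y contribute T^-N each, and 2 is at
    most \<open>T\<close>.\<close>
  have Py: "Py * T ^ N \<le> T"
  proof -
    have "Py \<le> cmod (poly (map_poly of_int P) w) + real n * (T ^ D * (real n * (T ^ (k + 2)) ^ n * cmod (y - w)))"
      unfolding Py_def by (rule poly_value_near[OF P P_le y_le' w_le one_le_power[OF T1(1)]])
    also have "real n * (T ^ D * (real n * (T ^ (k + 2)) ^ n * cmod (y - w))) \<le>
        T * (T ^ D * (T * (T ^ (k + 2)) ^ n * (1 / T ^ L)))"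
      using T1 T(2) y(2) by (intro mult_mono) (auto simp: norm_minus_commute)
    also have "\<dots> = 1 / T ^ N"
    proof -
      define u where "u = (T ^ (k + 2)) ^ n"
      have u: "u > 0" using T1 by (simp add: u_def)
      have TL: "T ^ L = T ^ D * T ^ 2 * u * T ^ N"
        by (simp only: L_def u_def power_add power_mult)
      show ?thesis
        unfolding u_def[symmetric] TL using T1 u by (simp add: field_simps power2_eq_square)
    qed
    finally have "Py * T ^ N \<le> (cmod (poly (map_poly of_int P) w) + 1 / T ^ N) * T ^ N"
      using T1 by (intro mult_right_mono) auto
    also have "\<dots> = cmod (poly (map_poly of_int P) w) * T ^ N + 1"
      using T1 by (simp add: distrib_right)
    also have "\<dots> \<le> T" using Pw T(1) by simp
    finally show ?thesis .
  qed
  define k1 where "k1 = k + n * (k + 2)"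
  have bez_g: "(A * h) * g + B * P = [:r:]" using bez(1) by (simp add: h mult_ac)
  have "1 \<le> fact (m + (n - 1)) * (T ^ k1) ^ (n - 1) * (T ^ D) ^ (m - 1) * (T ^ (k + 1)) ^ m * Py"
    unfolding Py_def k1_def
    by (rule resultant_lower_bound[OF m_def[symmetric] _ _ bez_g bez(2) g(4) g_le _ P_le _ y_le one_le_power[OF T1(1)]])
      (use g(2) P T1 in \<open>auto simp: m_def\<close>)
  \<comment> \<open>Here a proper factor pays off: m < n, so \<open>T ^ D\<close> enters at most n -
    2 times, and the other exponents do not involve \<open>D\<close>.\<close>
  also have "\<dots> \<le> T * (T ^ k1) ^ n * (T ^ D) ^ (n - 2) * (T ^ (k + 1)) ^ n * Py"
  proof (intro mult_right_mono mult_mono)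
    have "fact (m + (n - 1)) \<le> (fact (2 * n) :: real)" using g(3) by (intro fact_mono) (simp add: m_def)
    then show "fact (m + (n - 1)) \<le> T" using T(3) by linarith
  qed (use T1 one_le_power[OF T1(1), of "k + 1"] g(2,3) in \<open>auto intro!: power_increasing simp: m_def Py_def\<close>)
  also have "\<dots> = T ^ (1 + k1 * n + D * (n - 2) + (k + 1) * n) * Py"
    by (simp only: power_add power_mult power_one_right)
  finally have "T ^ N * 1 \<le> T ^ N * (T ^ (1 + k1 * n + D * (n - 2) + (k + 1) * n) * Py)"
    using T1 by (intro mult_left_mono) auto
  also have "\<dots> = T ^ (1 + k1 * n + D * (n - 2) + (k + 1) * n) * (Py * T ^ N)" by simp
  also have "\<dots> \<le> T ^ (1 + k1 * n + D * (n - 2) + (k + 1) * n) * T"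
    using Py T1 by (intro mult_left_mono) auto
  also have "\<dots> = T ^ (2 + k1 * n + D * (n - 2) + (k + 1) * n)" by simp
  also have "\<dots> < T ^ N" using N T(1) unfolding k1_def by (intro power_strict_increasing) auto
  finally show False by simp
qed

subsection \<open>Specialization at almost all integers\<close>

lemma eventually_cofinite_abs_ge:
  "eventually (\<lambda>c :: int. b \<le> \<bar>real_of_int c\<bar>) cofinite"
  unfolding eventually_cofinite
proof (rule finite_subset)
  show "{c. \<not> b \<le> \<bar>real_of_int c\<bar>} \<subseteq> {- \<lceil>b\<rceil>..\<lceil>b\<rceil>}"
    by (auto simp: abs_le_iff) linarith+
qed simp

lemma eventually_cofinite_poly_nonzero:
  fixes p :: "'a::{idom, ring_char_0} poly"
  assumes "p \<noteq> 0"
  shows "eventually (\<lambda>c :: int. poly p (of_int c) \<noteq> 0) cofinite"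
proof -
  have "finite (of_int -` {x. poly p x = 0} :: int set)"
    by (intro finite_vimageI poly_roots_finite[OF assms]) (simp add: inj_on_def)
  then show ?thesis unfolding eventually_cofinite by (simp add: vimage_def)
qed

text \<open>One extra power of |c| absorbs the coefficients, so that later bounds are pure powers of
  |c|.\<close>

lemma eventually_cofinite_poly_growth:
  fixes p :: "complex poly"
  assumes "degree p \<le> d"
  shows "eventually (\<lambda>c :: int. cmod (poly p (of_int c)) \<le> \<bar>real_of_int c\<bar> ^ (d + 1)) cofinite"
proof -
  define b where "b = (\<Sum>i\<le>degree p. cmod (coeff p i))"
  show ?thesis
    using eventually_cofinite_abs_ge[of "max 1 b"]
  proof eventually_elim
    case (elim c)
    define T where "T = \<bar>real_of_int c\<bar>"
    have T: "T \<ge> 1" "T \<ge> b" using elim by (auto simp: T_def)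
    have "cmod (poly p (of_int c)) \<le> (\<Sum>i\<le>degree p. cmod (coeff p i) * T ^ d)"
      unfolding poly_altdef
    proof (rule sum_norm_le)
      fix i assume "i \<in> {..degree p}"
      then show "cmod (coeff p i * of_int c ^ i) \<le> cmod (coeff p i) * T ^ d"
        using assms T by (auto simp: norm_mult norm_power T_def intro!: mult_left_mono power_increasing)
    qed
    also have "\<dots> = b * T ^ d" by (simp add: b_def sum_distrib_right)
    also have "\<dots> \<le> T * T ^ d" using T by (intro mult_right_mono) auto
    finally show ?case by (simp add: T_def)
  qed
qed

definition eval_rat :: "int \<Rightarrow> rat poly \<Rightarrow> complex" where
  "eval_rat c p = poly (map_poly of_rat p) (of_int c)"

lemma eval_rat_hom:
  "eval_rat c (p + q) = eval_rat c p + eval_rat c q"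
  "eval_rat c (p * q) = eval_rat c p * eval_rat c q"
  "eval_rat c 0 = 0" "eval_rat c 1 = 1"
  "eval_rat c (p ^ j) = eval_rat c p ^ j"
  "eval_rat c (sum f A) = (\<Sum>i\<in>A. eval_rat c (f i))"
  "eval_rat c (monom 1 j) = of_int c ^ j"
  "eval_rat c (map_poly of_int a) = of_int (poly a c)"
proof -
  interpret of_rat_poly: map_poly_inj_idom_hom "of_rat :: rat \<Rightarrow> complex" ..
  show add: "eval_rat c (p + q) = eval_rat c p + eval_rat c q" for p q
    by (simp add: eval_rat_def of_rat_poly.hom_add)
  show mult: "eval_rat c (p * q) = eval_rat c p * eval_rat c q" for p q
    by (simp add: eval_rat_def of_rat_poly.hom_mult)
  show zero: "eval_rat c 0 = 0" and one: "eval_rat c 1 = 1"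
    by (simp_all add: eval_rat_def)
  show "eval_rat c (p ^ j) = eval_rat c p ^ j"
    by (induction j) (simp_all add: mult one)
  show "eval_rat c (sum f A) = (\<Sum>i\<in>A. eval_rat c (f i))"
    by (induction A rule: infinite_finite_induct) (simp_all add: add zero)
  show "eval_rat c (monom 1 j) = of_int c ^ j"
    by (simp add: eval_rat_def map_poly_monom poly_monom)
  have "map_poly (of_rat :: rat \<Rightarrow> complex) (map_poly of_int a) = map_poly of_int a"
    by (intro poly_eqI) (simp add: coeff_map_poly)
  then show "eval_rat c (map_poly of_int a) = of_int (poly a c)"
    by (simp add: eval_rat_def of_int_hom.poly_map_poly)
qed

lemma eventually_cofinite_eval_rat:
  assumes "degree p \<le> d"
  shows "eventually (\<lambda>c. cmod (eval_rat c p) \<le> \<bar>real_of_int c\<bar> ^ (d + 1)) cofinite"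
  unfolding eval_rat_def using assms
  by (intro eventually_cofinite_poly_growth order.trans[OF degree_map_poly_le])

lemma eventually_cofinite_int_poly:
  fixes p :: "int poly"
  assumes "degree p \<le> d"
  shows "eventually (\<lambda>c. \<bar>real_of_int (poly p c)\<bar> \<le> \<bar>real_of_int c\<bar> ^ (d + 1)) cofinite"
  using eventually_cofinite_eval_rat[of "map_poly of_int p" d] assms
  by (simp add: eval_rat_hom)

section \<open>Specialization of integral models at t = c\<close>

definition specialize_int :: "int \<Rightarrow> int poly poly \<Rightarrow> int poly" where
  "specialize_int c Q = map_poly (\<lambda>a. poly a c) Q"

lemma coeff_specialize_int: "coeff (specialize_int c Q) i = poly (coeff Q i) c"
  by (simp add: specialize_int_def coeff_map_poly)

lemma specialize_int_hom:
  "specialize_int c (p + q) = specialize_int c p + specialize_int c q"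
  "specialize_int c (p * q) = specialize_int c p * specialize_int c q"
  "specialize_int c [:r:] = [:poly r c:]"
proof -
  show "specialize_int c (p + q) = specialize_int c p + specialize_int c q"
    by (intro poly_eqI) (simp add: coeff_specialize_int)
  show "specialize_int c (p * q) = specialize_int c p * specialize_int c q"
    by (intro poly_eqI) (simp add: coeff_specialize_int coeff_mult poly_sum)
  show "specialize_int c [:r:] = [:poly r c:]"
    by (intro poly_eqI) (simp add: coeff_specialize_int coeff_pCons split: nat.split)
qed

lemma degree_specialize_int_le: "degree (specialize_int c Q) \<le> degree Q"
  unfolding specialize_int_def by (rule degree_map_poly_le)

text \<open>The sum is t^(M n) Q(t, t^k G/t^M), evaluated here at t = c. This serves both F, with n,
  and the auxiliary polynomial, with n - 1.\<close>

lemma specialize_int_approximate_root: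
  assumes c: "c \<noteq> 0" and n: "degree Q \<le> n"
  shows "poly (map_poly of_int (specialize_int c Q)) (eval_rat c G * of_int c ^ k / of_int c ^ M) * of_int c ^ (M * n) =
    eval_rat c (\<Sum>i\<le>n. map_poly of_int (coeff Q i) * monom 1 (k * i + M * (n - i)) * G ^ i)"
proof -
  define z :: complex where "z = of_int c"
  have z: "z \<noteq> 0" using c by (simp add: z_def)
  define w where "w = eval_rat c G * z ^ k / z ^ M"
  have "poly (map_poly of_int (specialize_int c Q)) w = (\<Sum>i\<le>n. of_int (poly (coeff Q i) c) * w ^ i)"
  proof -
    have "poly (map_poly of_int (specialize_int c Q)) w =
        (\<Sum>i\<le>degree (specialize_int c Q). of_int (poly (coeff Q i) c) * w ^ i)"
      by (simp add: poly_altdef coeff_map_poly coeff_specialize_int)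
    also have "\<dots> = (\<Sum>i\<le>n. of_int (poly (coeff Q i) c) * w ^ i)"
    proof (intro sum.mono_neutral_left ballI)
      fix i assume "i \<in> {..n} - {..degree (specialize_int c Q)}"
      then have "coeff (specialize_int c Q) i = 0" by (intro coeff_eq_0) auto
      then show "of_int (poly (coeff Q i) c) * w ^ i = 0" by (simp add: coeff_specialize_int)
    qed (use degree_specialize_int_le[of c Q] n in auto)
    finally show ?thesis .
  qed
  then have "poly (map_poly of_int (specialize_int c Q)) w * z ^ (M * n) =
      (\<Sum>i\<le>n. of_int (poly (coeff Q i) c) * w ^ i * z ^ (M * n))"
    by (simp add: sum_distrib_right)
  also have "\<dots> = (\<Sum>i\<le>n. of_int (poly (coeff Q i) c) * z ^ (k * i + M * (n - i)) * eval_rat c G ^ i)"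
  proof (rule sum.cong)
    fix i assume "i \<in> {..n}"
    then have "M * n = M * (n - i) + M * i" by (simp flip: distrib_left)
    then have "z ^ (M * n) = z ^ (M * (n - i)) * (z ^ M) ^ i" by (simp add: power_add power_mult)
    moreover have "z ^ (k * i) = (z ^ k) ^ i" by (rule power_mult)
    ultimately show "of_int (poly (coeff Q i) c) * w ^ i * z ^ (M * n) =
        of_int (poly (coeff Q i) c) * z ^ (k * i + M * (n - i)) * eval_rat c G ^ i"
      using z by (simp add: w_def power_add power_mult_distrib power_divide)
  qed simp
  also have "\<dots> = eval_rat c (\<Sum>i\<le>n. map_poly of_int (coeff Q i) * monom 1 (k * i + M * (n - i)) * G ^ i)"
    by (simp add: eval_rat_hom z_def)
  finally show ?thesis by (simp add: w_def z_def)
qed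

text \<open>Away from the poles of the finitely many nonzero coefficients of f and from the zeros of
  q, the identity q f = F can be evaluated at c.\<close>

lemma eventually_specialize:
  assumes q: "q \<noteq> 0" and F: "smult (ratfun_of_int_poly q) f = map_poly ratfun_of_int_poly F"
  shows "eventually (\<lambda>c. poly q c \<noteq> 0 \<and> specializable (of_int c) f \<and>
    specialize (of_int c) f = smult (1 / of_int (poly q c)) (map_poly of_int (specialize_int c F))) cofinite"
proof -
  have coeff_eq: "ratfun_of_int_poly q * coeff f i = ratfun_of_int_poly (coeff F i)" for i
    using arg_cong[OF F, of "\<lambda>p. coeff p i"] by (simp add: coeff_map_poly)
  have ev: "eventually (\<lambda>c :: int. \<forall>i\<in>{..degree f}. poly (snd (quot_of_fract (coeff f i))) (of_int c) \<noteq> 0) cofinite"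
    by (intro eventually_ball_finite ballI eventually_cofinite_poly_nonzero) auto
  have "eventually (\<lambda>c :: int. poly q (of_int c) \<noteq> 0) cofinite"
    by (rule eventually_cofinite_poly_nonzero[OF q])
  with ev show ?thesis
  proof eventually_elim
    case (elim c)
    have regular: "regular_at (of_int c) (coeff f i)" for i
      using elim(1) by (cases "i \<le> degree f") (auto simp: regular_at_def coeff_eq_0)
    have "ratfun_eval (of_int c) (coeff f i) = of_int (poly (coeff F i) c) / of_int (poly q c)" for i
    proof -
      obtain a b where ab: "quot_of_fract (coeff f i) = (a, b)" by fastforce
      have b: "poly b (of_int c) \<noteq> 0" using regular[of i] ab by (simp add: regular_at_def)
      have "coeff f i = Fraction_Field.Fract a b" using Fract_quot_of_fract[of "coeff f i"] ab by (metis fst_conv snd_conv)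
      then have "Fraction_Field.Fract (map_poly of_int q * a) b = Fraction_Field.Fract (map_poly of_int (coeff F i)) 1"
        using coeff_eq[of i] by (simp add: ratfun_of_int_poly_def to_fract_def)
      moreover have "b \<noteq> 0" using b by auto
      ultimately have "map_poly of_int q * a = map_poly of_int (coeff F i) * b" by (simp add: eq_fract)
      then have "poly (map_poly of_int q * a) (of_int c) = poly (map_poly of_int (coeff F i) * b) (of_int c)" by simp
      then have "of_int (poly q c) * poly a (of_int c) = of_int (poly (coeff F i) c) * poly b (of_int c)"
        by (simp add: of_int_hom.poly_map_poly)
      then show ?thesis using b elim(2) by (simp add: ratfun_eval_def ab field_simps)
    qed
    then have "specialize (of_int c) f = smult (1 / of_int (poly q c)) (map_poly of_int (specialize_int c F))"
      by (intro poly_eqI)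
        (simp add: specialize_def coeff_map_poly ratfun_eval_def coeff_specialize_int)
    then show ?case using regular elim(2) by (simp add: specializable_def)
  qed
qed

text \<open>At any complex root, \<open>reducible_root_factor\<close> would yield a factor of degree
  strictly between 0 and 1.\<close>

lemma irreducible_linear_specialization:
  fixes F :: "int poly"
  assumes "degree F = 1" "a \<noteq> 0"
  shows "Factorial_Ring.irreducible (smult a (map_poly of_int F) :: rat poly)"
proof (rule ccontr)
  assume red: "\<not> ?thesis"
  have "\<not> constant (poly (map_poly of_int F :: complex poly))"
    using assms(1) by (simp add: constant_degree)
  then obtain y :: complex where y: "poly (map_poly of_int F) y = 0"
    using fundamental_theorem_of_algebra by blast
  obtain g where "0 < degree g" "degree g < degree F"
    using reducible_root_factor[OF red assms(2) _ y] assms(1) by auto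
  then show False using assms(1) by simp
qed

section \<open>Combining the estimates\<close>

lemma eventually_degree_specialize_int:
  assumes "F \<noteq> 0"
  shows "eventually (\<lambda>c. degree (specialize_int c F) = degree F) cofinite"
proof -
  have "eventually (\<lambda>c :: int. poly (lead_coeff F) (of_int c) \<noteq> 0) cofinite"
    using assms by (intro eventually_cofinite_poly_nonzero) simp
  then show ?thesis
  proof eventually_elim
    case (elim c)
    then have "degree F \<le> degree (specialize_int c F)"
      by (intro le_degree) (simp add: coeff_specialize_int)
    then show ?case using degree_specialize_int_le[of c F] by simp
  qed
qed

text \<open>What remains is to choose the parameters. The count allows \<open>N\<close> up to about
  (n - 1) D, whereas the resultant asks for (n - 2) D plus terms independent of \<open>D\<close>; a
  large \<open>D\<close> meets both.\<close>

lemma eventually_irreducible_specialization: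
  fixes F :: "int poly poly"
  assumes n: "degree F = n" "n \<ge> 2"
    and bezout: "\<And>P. P \<noteq> 0 \<Longrightarrow> degree P < n \<Longrightarrow> \<exists>A B r. r \<noteq> 0 \<and> A * F + B * P = [:r:]"
    and approx: "\<And>M. \<exists>G :: rat poly. degree G \<le> M \<and>
      degree (\<Sum>i\<le>n. map_poly of_int (coeff F i) * monom 1 (k * i + M * (n - i)) * G ^ i) + M \<le> M * n + e"
  shows "eventually (\<lambda>c. \<forall>a. a \<noteq> 0 \<longrightarrow>
    Factorial_Ring.irreducible (smult a (map_poly of_int (specialize_int c F)) :: rat poly)) cofinite"
proof -
  obtain m where "n = 2 + m" using n(2) le_iff_add by blast
  then have m: "n = Suc (Suc m)" by simp
  \<comment> \<open>The final 1 is the extra power of |c| in the growth bound.\<close>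
  define s where "s = (\<Sum>i\<le>n. degree (coeff F i)) + 1"
  define K where "K = (s + n * (s + 2)) * n + (s + 1) * n"
  \<comment> \<open>\<open>K\<close> collects the terms of the resultant bound free of
    \<open>D\<close>. With this \<open>D\<close> the two sides of the counting inequality differ by
    exactly one.\<close>
  define D where "D = k * (n - 1) + 3 + K"
  \<comment> \<open>\<open>D + 1\<close> replaces \<open>D\<close> because coefficients of degree at
    most \<open>D\<close> in t are bounded by |c|^(D + 1).\<close>
  define N where "N = 3 + K + (D + 1) * (n - 2)"
  define L where "L = D + 1 + 2 + (s + 2) * n + N"
  \<comment> \<open>The precision is chosen last: it must beat n L + e, so that F(c, w) is small
    enough, and be at least \<open>Suc N\<close>.\<close>
  define M where "M = n * L + e + 2 + Suc N"
  obtain G :: "rat poly" where G: "degree G \<le> M"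
    "degree (\<Sum>i\<le>n. map_poly of_int (coeff F i) * monom 1 (k * i + M * (n - i)) * G ^ i) + M \<le> M * n + e"
    using approx[of M] by blast
  define B where "B = (\<Sum>i\<le>n. map_poly of_int (coeff F i) * monom 1 (k * i + M * (n - i)) * G ^ i)"
  have "n * (D + 1) = (D + 1) * (n - 2) + (D + 1) + (D + 1)" by (simp add: m)
  \<comment> \<open>\<open>Suc N\<close> rather than \<open>N\<close>: the additional order of
    vanishing pays for the extra power of |c| in the growth bound for \<open>E\<close>.\<close>
  then have "D + k * (n - 1) + Suc N < n * (D + 1)"
    using D_def N_def by linarith
  moreover have "Suc N \<le> M * (n - 1)" by (simp add: m M_def)
  ultimately obtain P :: "int poly poly" where P: "P \<noteq> 0" "degree P < n" "\<And>i. degree (coeff P i) \<le> D"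
    "degree (\<Sum>i<n. map_poly of_int (coeff P i) * monom 1 (k * i + M * (n - 1 - i)) * G ^ i) + Suc N \<le> M * (n - 1)"
    using auxiliary_polynomial[OF G(1)] by blast
  define E where "E = (\<Sum>i\<le>n - 1. map_poly of_int (coeff P i) * monom 1 (k * i + M * (n - 1 - i)) * G ^ i)"
  have E: "degree E + Suc N \<le> M * (n - 1)"
    using P(4) unfolding E_def m by (simp add: lessThan_Suc_atMost)
  obtain A C r where bez: "r \<noteq> 0" "A * F + C * P = [:r:]" using bezout[OF P(1,2)] by blast
  define T0 :: real where "T0 = max 2 (max (real n + 1) (fact (2 * n)))"
  have "eventually (\<lambda>c. T0 \<le> \<bar>real_of_int c\<bar>) cofinite" by (rule eventually_cofinite_abs_ge)
  moreover have "eventually (\<lambda>c. \<forall>i\<in>{..n}. \<bar>real_of_int (poly (coeff F i) c)\<bar> \<le> \<bar>real_of_int c\<bar> ^ s) cofinite"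
    unfolding s_def
    by (intro eventually_ball_finite ballI eventually_cofinite_int_poly member_le_sum) auto
  moreover have "eventually (\<lambda>c. \<forall>i\<in>{..n}. \<bar>real_of_int (poly (coeff P i) c)\<bar> \<le> \<bar>real_of_int c\<bar> ^ (D + 1)) cofinite"
    by (intro eventually_ball_finite ballI eventually_cofinite_int_poly P(3)) auto
  moreover have "eventually (\<lambda>c. cmod (eval_rat c B) \<le> \<bar>real_of_int c\<bar> ^ (degree B + 1)) cofinite"
    by (rule eventually_cofinite_eval_rat) simp
  moreover have "eventually (\<lambda>c. cmod (eval_rat c E) \<le> \<bar>real_of_int c\<bar> ^ (degree E + 1)) cofinite"
    by (rule eventually_cofinite_eval_rat) simp
  moreover have "eventually (\<lambda>c :: int. poly r (of_int c) \<noteq> 0) cofinite"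
    by (rule eventually_cofinite_poly_nonzero[OF bez(1)])
  moreover have "eventually (\<lambda>c. degree (specialize_int c F) = degree F) cofinite"
    by (rule eventually_degree_specialize_int) (use n in auto)
  ultimately show ?thesis
  proof eventually_elim
    case (elim c)
    define T where "T = \<bar>real_of_int c\<bar>"
    have T: "T \<ge> 2" "T \<ge> real n + 1" "T \<ge> fact (2 * n)" using elim(1) by (auto simp: T0_def T_def)
    have c0: "c \<noteq> 0" using T(1) by (auto simp: T_def)
    have norm_c: "cmod (of_int c) = T" by (simp add: T_def)
    define w where "w = eval_rat c G * of_int c ^ k / of_int c ^ M"
    define Fc where "Fc = specialize_int c F"
    define Pc where "Pc = specialize_int c P"
    have F_le: "\<bar>real_of_int (coeff Fc i)\<bar> \<le> T ^ s" for i
      using elim(2) T(1) n(1) by (cases "i \<le> n") (auto simp: Fc_def coeff_specialize_int T_def coeff_eq_0)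
    have P_le: "\<bar>real_of_int (coeff Pc i)\<bar> \<le> T ^ (D + 1)" for i
      using elim(3) T(1) P(2) by (cases "i \<le> n") (auto simp: Pc_def coeff_specialize_int T_def coeff_eq_0)
    have Fw: "cmod (poly (map_poly of_int Fc) w) * T ^ (n * L) < 1"
    proof -
      have "cmod (poly (map_poly of_int Fc) w) * T ^ (M * n) = cmod (eval_rat c B)"
        using specialize_int_approximate_root[OF c0 eq_imp_le[OF n(1)], of G k M]
        unfolding w_def[symmetric] Fc_def[symmetric] B_def[symmetric]
        by (metis norm_mult norm_power norm_c)
      also have "\<dots> \<le> T ^ (degree B + 1)" using elim(4) by (simp add: T_def)
      finally have "cmod (poly (map_poly of_int Fc) w) * T ^ (M * n) * T ^ (n * L) \<le> T ^ (degree B + 1) * T ^ (n * L)"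
        using T(1) by (intro mult_right_mono) auto
      also have "\<dots> = T ^ (degree B + 1 + n * L)" by (rule power_add[symmetric])
      also have "\<dots> < T ^ (M * n)"
      proof (rule power_strict_increasing)
        show "degree B + 1 + n * L < M * n"
          using G(2) M_def unfolding B_def[symmetric] by linarith
      qed (use T(1) in simp)
      finally have "T ^ (M * n) * (cmod (poly (map_poly of_int Fc) w) * T ^ (n * L)) < T ^ (M * n) * 1"
        by (simp add: mult_ac)
      then show ?thesis by (rule mult_left_less_imp_less) (use T(1) in simp)
    qed
    have Pw: "cmod (poly (map_poly of_int Pc) w) * T ^ N \<le> 1"
    proof -
      have "degree P \<le> n - 1" using P(2) by simp
      then have "cmod (poly (map_poly of_int Pc) w) * T ^ (M * (n - 1)) = cmod (eval_rat c E)"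
        using specialize_int_approximate_root[OF c0, of P "n - 1" G k M]
        unfolding w_def[symmetric] Pc_def[symmetric] E_def[symmetric]
        by (metis norm_mult norm_power norm_c)
      also have "\<dots> \<le> T ^ (degree E + 1)" using elim(5) by (simp add: T_def)
      finally have "cmod (poly (map_poly of_int Pc) w) * T ^ (M * (n - 1)) * T ^ N \<le> T ^ (degree E + 1) * T ^ N"
        using T(1) by (intro mult_right_mono) auto
      also have "\<dots> = T ^ (degree E + 1 + N)" by (rule power_add[symmetric])
      also have "\<dots> \<le> T ^ (M * (n - 1))"
        using E T(1) by (intro power_increasing) auto
      finally have "T ^ (M * (n - 1)) * (cmod (poly (map_poly of_int Pc) w) * T ^ N) \<le> T ^ (M * (n - 1)) * 1"
        by (simp add: mult_ac)
      then show ?thesis by (rule mult_left_le_imp_le) (use T(1) in simp)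
    qed
    have "specialize_int c A * Fc + specialize_int c C * Pc = [:poly r c:]"
      using arg_cong[OF bez(2), of "specialize_int c"] by (simp add: specialize_int_hom Fc_def Pc_def)
    moreover have "poly r c \<noteq> 0" using elim(6) by simp
    moreover have "degree Fc = n" using elim(7) n(1) by (simp add: Fc_def)
    moreover have "degree Pc < n" using degree_specialize_int_le[of c P] P(2) by (simp add: Pc_def)
    moreover have "N \<ge> 3 + (s + n * (s + 2)) * n + (D + 1) * (n - 2) + (s + 1) * n"
      by (simp add: N_def K_def)
    ultimately show ?case
      using no_proper_factor_near_approximate_root[OF _ _ T F_le _ P_le Fw[unfolded L_def] Pw] n(2)
      unfolding Fc_def by (metis less_le_trans zero_less_numeral)
  qed
qed

theorem theorem5p4:
  fixes f :: "ratfun poly" and x :: "ratfun alg_closure"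
  assumes "Factorial_Ring.irreducible f"
    and "poly (map_poly to_ac f) x = 0"
    and "\<exists>V. place_above_infinity x V \<and> rational_place V \<and> unramified_place x V"
  shows "finite {c :: int. \<not> (specializable (of_int c) f \<and>
                                Factorial_Ring.irreducible (specialize (of_int c) f))}"
proof -
  obtain V where V: "place_above_infinity x V" "rational_place V" "unramified_place x V"
    using assms(3) by blast
  obtain q F where q: "q \<noteq> 0" and F: "smult (ratfun_of_int_poly q) f = map_poly ratfun_of_int_poly F"
    using clear_denominators_ratfun by blast
  define n where "n = degree F"
  have q0: "ratfun_of_int_poly q \<noteq> 0" using q by simp
  have "degree f = degree (smult (ratfun_of_int_poly q) f)" using q0 by simp
  also have "\<dots> = n" unfolding F n_def by simp
  finally have deg_f: "degree f = n" .
  have "f \<noteq> 0" "\<not> is_unit f" using assms(1) by (auto simp: irreducible_def)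
  then have n: "n > 0" using deg_f by (auto simp: is_unit_iff_degree)
  \<comment> \<open>All nonzero multiples are treated at once, because the factor 1/q(c) to be used
    varies with c.\<close>
  have "eventually (\<lambda>c. \<forall>a. a \<noteq> 0 \<longrightarrow>
    Factorial_Ring.irreducible (smult a (map_poly of_int (specialize_int c F)) :: rat poly)) cofinite"
  \<comment> \<open>The estimate is run for n at least 2; degree one is immediate once the degree
    survives specialization.\<close>
  proof (cases "n = 1")
    case True
    then have "F \<noteq> 0" unfolding n_def by auto
    from eventually_degree_specialize_int[OF this] show ?thesis
      by eventually_elim (use True irreducible_linear_specialization in \<open>auto simp: n_def\<close>)
  next
    case False
    define F' :: "rat poly poly" where "F' = map_poly (map_poly of_int) F"
    have coeff_F': "coeff F' i = map_poly of_int (coeff F i)" for i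
      by (simp add: F'_def coeff_map_poly)
    have deg_F': "degree F' = n" unfolding F'_def n_def by (rule degree_map_poly) simp
    have "map_poly (\<lambda>a. to_ac (to_fract a)) F' = map_poly to_ac (smult (ratfun_of_int_poly q) f)"
      unfolding F by (intro poly_eqI) (simp add: coeff_map_poly coeff_F' ratfun_of_int_poly_def)
    also have "\<dots> = smult (to_ac (ratfun_of_int_poly q)) (map_poly to_ac f)"
      by (intro poly_eqI) (simp add: coeff_map_poly)
    finally have root: "poly (map_poly (\<lambda>a. to_ac (to_fract a)) F') x = 0"
      using assms(2) by simp
    obtain k e where approx: "\<And>M. \<exists>G. degree G \<le> M \<and>
      degree (\<Sum>i\<le>n. coeff F' i * monom 1 (k * i + M * (n - i)) * G ^ i) + M \<le> M * n + e"
      using place_approximate_root[OF V root deg_F'[symmetric] n] by blast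
    show ?thesis
    proof (rule eventually_irreducible_specialization)
      show "degree F = n" "n \<ge> 2" using n False by (simp_all add: n_def)
      show "\<exists>A B r. r \<noteq> 0 \<and> A * F + B * P = [:r:]" if "P \<noteq> 0" "degree P < n" for P
        using bezout_int_poly_poly[OF assms(1) F q] that by (simp add: n_def)
      show "\<exists>G :: rat poly. degree G \<le> M \<and>
        degree (\<Sum>i\<le>n. map_poly of_int (coeff F i) * monom 1 (k * i + M * (n - i)) * G ^ i) + M \<le> M * n + e" for M
        by (rule approx[unfolded coeff_F'])
    qed
  qed
  with eventually_specialize[OF q F]
  have "eventually (\<lambda>c :: int. specializable (of_int c) f \<and>
      Factorial_Ring.irreducible (specialize (of_int c) f)) cofinite"
  proof eventually_elim
    case (elim c)
    have "1 / of_int (poly q c) \<noteq> (0 :: rat)" using elim(1) by simp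
    then have "Factorial_Ring.irreducible (smult (1 / of_int (poly q c)) (map_poly of_int (specialize_int c F)) :: rat poly)"
      using elim(2) by blast
    then show ?case using elim(1) by (elim conjE) (simp only: simp_thms)
  qed
  then show ?thesis unfolding eventually_cofinite .
qed

end
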